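(* (i) There exists an absolute constant $C>0$ such that for every integer $n\ge 2$, any set $V$ of $n$ points in general position in the plane determines at least $n/2^{C\sqrt{\log n}}$ pairwise crossing segments. (ii) There exists an absolute constant $c$ such that for every integer $n\ge 2$ and every real $\varepsilon>(\log n)^{-2/3}$, any geometric graph with $n$ vertices and at least $n^{2-\varepsilon}$ edges has at least $n^{1-c\sqrt{\varepsilon}}$ pairwise crossing edges.
   Context: A set of points in the plane $\mathbb{R}^2$ is in general position if no three of its points are collinear. A segment is determined by $V$ if both of its (distinct) endpoints belong to $V$. A geometric graph is a finite simple graph $G=(V,E)$ whose vertex set $V$ is a set of points in general position in the plane and whose edges are represented by (possibly crossing) straight-line segments connecting certain pairs of points of $V$. Two segments (edges) cross if they share an interior point, i.e. a point in the relative interior of both. A family of segments is pairwise crossing if any two distinct members cross; a family consisting of one segment counts as pairwise crossing. "At least $T$ pairwise crossing segments (edges)" means that there is a family of at least $T$ segments determined by $V$ (edges of the graph) that is pairwise crossing. The base of the logarithm is a fixed one (e.g. 2). *)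

theory Defs
  imports "HOL-Analysis.Analysis"
begin

type_synonym point = "real ^ 2"

definition general_position :: "point set \<Rightarrow> bool" where
  "general_position V \<longleftrightarrow> (\<forall>T. T \<subseteq> V \<and> card T = 3 \<longrightarrow> \<not> collinear T)"

text \<open>A segment is encoded by the set of its two distinct endpoints;
  the segment as a point set is the convex hull of that set.\<close>

definition segments_of :: "point set \<Rightarrow> point set set" where
  "segments_of V = {e. e \<subseteq> V \<and> card e = 2}"

definition segments_cross :: "point set \<Rightarrow> point set \<Rightarrow> bool" where
  "segments_cross e f \<longleftrightarrow> rel_interior (convex hull e) \<inter> rel_interior (convex hull f) \<noteq> {}"

definition geometric_graph :: "point set \<Rightarrow> point set set \<Rightarrow> bool" where
  "geometric_graph V E \<longleftrightarrow> finite V \<and> general_position V \<and> E \<subseteq> segments_of V"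

end

theory Submission
  imports Defs
begin

text \<open>Both parts follow from one bound: a geometric graph with \<open>n\<close> vertices and at least \<open>\<delta> n\<^sup>2\<close> edges,
  where \<open>0 < \<delta> \<le> 1\<close>, has at least \<open>\<delta> ^ 6 n / 2 ^ 30\<close> pairwise crossing edges (\<open>exists_crossing_family_dense\<close>). For a complete graph
  this is linear in \<open>n\<close>, and for \<open>\<delta> = n powr - \<epsilon>\<close> it loses only a factor \<open>n powr (6 * \<epsilon>)\<close>, besides the
  constant.

  The heart is a statement about two sets \<open>A\<close> and \<open>B\<close> that lie to the left and to the right of a line.
  For \<open>a\<close> in \<open>A\<close> and \<open>b\<close> in \<open>B\<close> let the level of \<open>(a, b)\<close> be the number of points of \<open>A\<close> below the line
  \<open>ab\<close> minus the number of points of \<open>B\<close> above it. Fix \<open>a\<close> and turn the line clockwise about \<open>a\<close>. At each point of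
  \<open>B\<close> that it passes the second number grows by one, whereas the first number changes only when the line
  passes over a point \<open>a'\<close> of \<open>A\<close>. If few lines \<open>aa'\<close> have points of \<open>B\<close> on both
  sides, then the level decreases along this rotation except at few segments; a rising sun lemma bounds
  their number by the number of such lines (\<open>card_overtaken_le\<close>). In the same way the level increases when
  the line turns about a fixed \<open>b\<close>. Now two segments \<open>ab\<close> and \<open>cd\<close> of the same level
  that are not exceptional must cross: if they do not, then one of the segments \<open>ad\<close> and \<open>cb\<close> is reached from
  \<open>ab\<close> and from \<open>cd\<close> by rotations that force its level to be both smaller and larger than
  the common level (\<open>exists_crossing_entries\<close>). As there are at most \<open>card A + card B\<close> levels, some level contains a
  large crossing family.

  It remains to find, among the given points, two separated sets of proportional size with many edges between them, such that
  few of the lines spanned by one set split the other. A line misses one of the four parts of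
  a ham-sandwich cut; after \<open>m\<close> rounds of cutting a line splits at most the fraction \<open>(3 / 4) ^ m\<close> of the
  \<open>4 ^ m\<close> parts (\<open>exists_partition_few_split\<close>). Averaging over pairs of parts then yields the two sets, as soon as
  \<open>(3 / 4) ^ m\<close> is small compared with \<open>\<delta>\<close>.\<close>

section \<open>Levels in a matrix of slopes\<close>

text \<open>A discrete rising sun lemma. Read the elements of \<open>B\<close> in the order of \<open>f\<close>; each step costs one
  unit, and \<open>b\<close> is overtaken if \<open>card (S _)\<close> has grown, at some later \<open>c\<close>, by at least the number of
  steps taken. Cut off the first overtaken stretch, from \<open>b\<close> to \<open>c\<close>: it has at most
  \<open>card (S c - S b)\<close> elements. Since an element that has entered \<open>S\<close> never leaves it and so
  never enters again, the elements that pay for this stretch do not pay for another one.\<close>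

lemma card_overtaken_le:
  fixes f :: "'b \<Rightarrow> real" and S :: "'b \<Rightarrow> 'a set"
  assumes "finite B" and "inj_on f B" and "\<And>b. b \<in> B \<Longrightarrow> finite (S b)"
    and "\<And>x b1 b2 b3. \<lbrakk>b1 \<in> B; b2 \<in> B; b3 \<in> B; f b1 < f b2; f b2 < f b3; x \<notin> S b1; x \<in> S b2\<rbrakk> \<Longrightarrow> x \<in> S b3"
  shows "card {b \<in> B. \<exists>c\<in>B. f b < f c \<and> card (S b) + card {x \<in> B. f b \<le> f x \<and> f x < f c} \<le> card (S c)}
       \<le> card {x. \<exists>b\<in>B. \<exists>c\<in>B. f b < f c \<and> x \<notin> S b \<and> x \<in> S c}"
    (is "card (?bad B) \<le> card (?new B)")
  using assms
proof (induction B rule: finite_psubset_induct)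
  case (psubset B)
  have fin_new: "finite (?new T)" if "T \<subseteq> B" for T
  proof (rule finite_subset)
    show "?new T \<subseteq> (\<Union>c\<in>B. S c)" using that by auto
    show "finite (\<Union>c\<in>B. S c)" using psubset by auto
  qed
  have IH: "card (?bad T) \<le> card (?new T)" if "T \<subset> B" for T
  proof (rule psubset.IH[OF that])
    show "inj_on f T" using psubset.prems(1) that by (meson inj_on_subset psubset_imp_subset)
    show "\<And>b. b \<in> T \<Longrightarrow> finite (S b)" using psubset.prems(2) that by auto
    show "x \<in> S b3" if "b1 \<in> T" "b2 \<in> T" "b3 \<in> T" "f b1 < f b2" "f b2 < f b3" "x \<notin> S b1" "x \<in> S b2"
      for x b1 b2 b3
      by (rule psubset.prems(3)[of b1 b2]) (use that \<open>T \<subset> B\<close> in auto)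
  qed
  show ?case
  proof (cases "B = {}")
    case True
    then show ?thesis by simp
  next
    case False
    obtain b0 where b0: "b0 \<in> B" and b0min: "\<And>b. b \<in> B \<Longrightarrow> f b0 \<le> f b"
      using arg_min_if_finite[OF psubset.hyps False, of f] by (metis not_le)
    have b0less: "f b0 < f b" if "b \<in> B" "b \<noteq> b0" for b
      using b0min[OF that(1)] psubset.prems(1) b0 that by (metis inj_onD less_eq_real_def)
    show ?thesis
    proof (cases "b0 \<in> ?bad B")
      case False
      let ?T = "B - {b0}"
      have "?bad B \<subseteq> ?bad ?T"
      proof
        fix b assume b: "b \<in> ?bad B"
        then have "b \<noteq> b0" using False by auto
        have bB: "b \<in> B" using b by blast
        have gt: "f b0 < f b" using b0less[OF bB \<open>b \<noteq> b0\<close>] .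
        from b obtain c where c: "c \<in> B" "f b < f c"
          "card (S b) + card {x \<in> B. f b \<le> f x \<and> f x < f c} \<le> card (S c)" by blast
        have "{x \<in> ?T. f b \<le> f x \<and> f x < f c} = {x \<in> B. f b \<le> f x \<and> f x < f c}"
          using gt by auto
        moreover have "c \<noteq> b0" using c gt by auto
        ultimately have "\<exists>c\<in>?T. f b < f c \<and>
            card (S b) + card {x \<in> ?T. f b \<le> f x \<and> f x < f c} \<le> card (S c)"
          using c by (intro bexI[of _ c]) simp_all
        then show "b \<in> ?bad ?T" using bB \<open>b \<noteq> b0\<close> by simp
      qed
      then have "card (?bad B) \<le> card (?bad ?T)"
        by (intro card_mono) (use psubset.hyps in auto)
      also have "\<dots> \<le> card (?new ?T)" by (rule IH) (use b0 in auto)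
      also have "\<dots> \<le> card (?new B)"
        by (intro card_mono fin_new) auto
      finally show ?thesis .
    next
      case True
      then obtain c where c: "c \<in> B" "f b0 < f c"
        "card (S b0) + card {x \<in> B. f b0 \<le> f x \<and> f x < f c} \<le> card (S c)" by blast
      \<comment> \<open>The stretch from the first element up to what overtakes it is charged to \<open>S c - S b0\<close>.\<close>
      let ?L = "{x \<in> B. f x < f c}" and ?T = "{x \<in> B. f c \<le> f x}"
      have "{x \<in> B. f b0 \<le> f x \<and> f x < f c} = ?L" using b0min by auto
      then have "card ?L \<le> card (S c) - card (S b0)" using c(3) by simp
      also have "\<dots> \<le> card (S c - S b0)"
        by (rule diff_card_le_card_Diff) (use psubset.prems(2) b0 in auto)
      finally have L: "card ?L \<le> card (S c - S b0)" .
      have "?bad B \<subseteq> ?L \<union> ?bad ?T"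
      proof
        fix b assume b: "b \<in> ?bad B"
        then have bB: "b \<in> B" by blast
        from b obtain d where d: "d \<in> B" "f b < f d"
          "card (S b) + card {x \<in> B. f b \<le> f x \<and> f x < f d} \<le> card (S d)" by blast
        show "b \<in> ?L \<union> ?bad ?T"
        proof (cases "f b < f c")
          case True
          then show ?thesis using bB by simp
        next
          case False
          then have "{x \<in> ?T. f b \<le> f x \<and> f x < f d} = {x \<in> B. f b \<le> f x \<and> f x < f d}" by auto
          then have "\<exists>d\<in>?T. f b < f d \<and>
              card (S b) + card {x \<in> ?T. f b \<le> f x \<and> f x < f d} \<le> card (S d)"
            using d False by (intro bexI[of _ d]) simp_all
          then show ?thesis using bB False by simp
        qed
      qed
      then have "card (?bad B) \<le> card (?L \<union> ?bad ?T)"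
        by (intro card_mono) (use psubset.hyps in auto)
      also have "\<dots> \<le> card ?L + card (?bad ?T)" by (rule card_Un_le)
      also have "card (?bad ?T) \<le> card (?new ?T)"
      proof (rule IH)
        have "b0 \<notin> ?T" using c(2) by simp
        then show "?T \<subset> B" using b0 by blast
      qed
      also have "card ?L + card (?new ?T) \<le> card (S c - S b0) + card (?new ?T)" using L by simp
      also have "\<dots> = card ((S c - S b0) \<union> ?new ?T)"
      proof (rule card_Un_disjoint[symmetric])
        show "finite (S c - S b0)" using psubset.prems(2) c by auto
        show "finite (?new ?T)" by (rule fin_new) auto
        show "(S c - S b0) \<inter> ?new ?T = {}"
        proof (rule ccontr)
          assume "(S c - S b0) \<inter> ?new ?T \<noteq> {}"
          then obtain x b where x: "x \<in> S c" "x \<notin> S b0" "b \<in> B" "f c \<le> f b" "x \<notin> S b" by blast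
          then have "f c < f b" using psubset.prems(1) c(1) by (metis inj_onD less_eq_real_def)
          then show False using psubset.prems(3)[OF b0 c(1) x(3) c(2)] x by blast
        qed
      qed
      also have "\<dots> \<le> card (?new B)"
        by (intro card_mono fin_new) (use b0 c in auto)
      finally show ?thesis by simp
    qed
  qed
qed

text \<open>The rows and columns of a real matrix \<open>s\<close> stand for two sets of points on either side of a line, and
  \<open>s a b\<close> for the slope of the line through \<open>a\<close> and \<open>b\<close>. The first term of the level counts the points
  of \<open>A\<close> below this line, the second one the points of \<open>B\<close> above it.\<close>

definition level :: "'a set \<Rightarrow> 'b set \<Rightarrow> ('a \<Rightarrow> 'b \<Rightarrow> real) \<Rightarrow> 'a \<Rightarrow> 'b \<Rightarrow> int" where
  "level A B s a b = int (card {a' \<in> A. s a' b > s a b}) - int (card {b' \<in> B. s a b' > s a b})"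

text \<open>For points, these are the pairs whose connecting line has points of \<open>B\<close> on both sides.\<close>

definition switching :: "'a set \<Rightarrow> 'b set \<Rightarrow> ('a \<Rightarrow> 'b \<Rightarrow> real) \<Rightarrow> ('a \<times> 'a) set" where
  "switching A B s = {(a, a'). a \<in> A \<and> a' \<in> A \<and> (\<exists>b\<in>B. \<exists>c\<in>B. s a' b < s a b \<and> s a' c > s a c)}"

text \<open>For points, this says that each of the two segments has its endpoints on different sides of the line
  through the other one. It is asymmetric: \<open>e\<close> is the segment of larger slope.\<close>

definition crossing_entries :: "('a \<Rightarrow> 'b \<Rightarrow> real) \<Rightarrow> 'a \<times> 'b \<Rightarrow> 'a \<times> 'b \<Rightarrow> bool" where
  "crossing_entries s e f \<longleftrightarrow>
     (s (fst e) (snd f) < s (fst e) (snd e) \<and> s (fst f) (snd e) < s (fst e) (snd e) \<and>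
      s (fst f) (snd f) < s (fst e) (snd f) \<and> s (fst f) (snd f) < s (fst f) (snd e))"

text \<open>While \<open>b\<close> runs through \<open>B\<close> in the order in which it is seen from \<open>a\<close>, the line through \<open>a\<close> and \<open>b\<close>
  turns about \<open>a\<close> in one direction and passes over \<open>a'\<close> at most once. The order of \<open>s a' b\<close> and \<open>s a b\<close>
  is therefore decided by comparing \<open>s a b\<close> with a threshold, from a side that depends on \<open>a\<close> and \<open>a'\<close>.\<close>

definition row_threshold :: "'a set \<Rightarrow> 'b set \<Rightarrow> ('a \<Rightarrow> 'b \<Rightarrow> real) \<Rightarrow> bool" where
  "row_threshold A B s \<longleftrightarrow> (\<forall>a\<in>A. \<forall>a'\<in>A. \<exists>C D. \<forall>b\<in>B.
     (s a' b > s a b \<longleftrightarrow> D < C * s a b) \<and> (s a' b < s a b \<longleftrightarrow> D > C * s a b))"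

lemma level_transpose: "level B A (\<lambda>b a. s a b) b a = - level A B s a b"
  by (simp add: level_def)

lemma card_greater_uminus:
  fixes f :: "'a \<Rightarrow> real"
  assumes "finite A" "inj_on f A" "a \<in> A"
  shows "int (card {x \<in> A. f x < f a}) = int (card A) - 1 - int (card {x \<in> A. f x > f a})"
proof -
  have eq: "A = {x \<in> A. f x < f a} \<union> {x \<in> A. f x > f a} \<union> {a}"
  proof -
    have "x = a \<or> f x < f a \<or> f x > f a" if "x \<in> A" for x
      using inj_onD[OF assms(2) _ that assms(3)] by linarith
    then show ?thesis using assms(3) by auto
  qed
  have "card A = card ({x \<in> A. f x < f a} \<union> {x \<in> A. f x > f a} \<union> {a})"
    using arg_cong[OF eq, of card] .
  also have "\<dots> = card {x \<in> A. f x < f a} + card {x \<in> A. f x > f a} + card {a}"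
    using assms(1) by (subst card_Un_disjoint; auto)+
  finally show ?thesis by simp
qed

lemma level_uminus:
  assumes "finite A" "finite B" "a \<in> A" "b \<in> B" "inj_on (s a) B" "inj_on (\<lambda>a. s a b) A"
  shows "level A B (\<lambda>a b. - s a b) a b = int (card A) - int (card B) - level A B s a b"
  unfolding level_def
  using card_greater_uminus[of A "\<lambda>a. s a b" a] card_greater_uminus[of B "s a" b] assms by simp

lemma row_threshold_uminus:
  assumes "row_threshold A B s"
  shows "row_threshold A B (\<lambda>a b. - s a b)"
  unfolding row_threshold_def
proof (intro ballI)
  fix a a' assume "a \<in> A" "a' \<in> A"
  then obtain C D where "\<forall>b\<in>B. (s a' b > s a b \<longleftrightarrow> D < C * s a b) \<and> (s a' b < s a b \<longleftrightarrow> D > C * s a b)"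
    using assms unfolding row_threshold_def by meson
  then show "\<exists>C D. \<forall>b\<in>B. (- s a' b > - s a b \<longleftrightarrow> D < C * - s a b) \<and> (- s a' b < - s a b \<longleftrightarrow> D > C * - s a b)"
    by (intro exI[of _ C] exI[of _ "- D"]) simp
qed

lemma switching_uminus: "switching A B (\<lambda>a b. - s a b) = switching A B s"
  unfolding switching_def by auto

text \<open>Along row \<open>a\<close>, in the direction of decreasing entries, the second count of the level goes up by one at
  each step, so the level goes down unless the first count grows. The first count changes only through
  the \<open>a'\<close> that switch with \<open>a\<close>, each of them once. By the rising sun lemma at most that many entries are
  followed by one whose level is at least as high.\<close>

lemma card_row_late_le:
  fixes s :: "'a \<Rightarrow> 'b \<Rightarrow> real"
  assumes fin: "finite A" "finite B" and a: "a \<in> A"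
    and inj: "inj_on (s a) B" and col_inj: "\<And>b. b \<in> B \<Longrightarrow> inj_on (\<lambda>a. s a b) A"
    and thr: "row_threshold A B s"
  shows "card {b \<in> B. \<exists>c\<in>B. s a c < s a b \<and> level A B s a b \<le> level A B s a c}
       \<le> card (switching A B s `` {a})"
proof -
  let ?S = "\<lambda>b. {a' \<in> A. s a' b > s a b}" and ?f = "\<lambda>b. - s a b"
  have eq: "{b \<in> B. \<exists>c\<in>B. s a c < s a b \<and> level A B s a b \<le> level A B s a c} =
        {b \<in> B. \<exists>c\<in>B. ?f b < ?f c \<and> card (?S b) + card {x \<in> B. ?f b \<le> ?f x \<and> ?f x < ?f c} \<le> card (?S c)}"
  proof -
    have "s a c < s a b \<and> level A B s a b \<le> level A B s a c \<longleftrightarrow>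
          ?f b < ?f c \<and> card (?S b) + card {x \<in> B. ?f b \<le> ?f x \<and> ?f x < ?f c} \<le> card (?S c)"
      for b c
    proof (cases "s a c < s a b")
      case True
      have "{x \<in> B. s a x > s a c} = {x \<in> B. s a x > s a b} \<union> {x \<in> B. ?f b \<le> ?f x \<and> ?f x < ?f c}"
        using True by auto
      moreover have "card ({x \<in> B. s a x > s a b} \<union> {x \<in> B. ?f b \<le> ?f x \<and> ?f x < ?f c}) =
            card {x \<in> B. s a x > s a b} + card {x \<in> B. ?f b \<le> ?f x \<and> ?f x < ?f c}"
        by (rule card_Un_disjoint) (use fin in auto)
      ultimately have "card {x \<in> B. s a x > s a c} =
            card {x \<in> B. s a x > s a b} + card {x \<in> B. ?f b \<le> ?f x \<and> ?f x < ?f c}"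
        by simp
      then show ?thesis using True unfolding level_def by auto
    qed simp
    then show ?thesis by (simp only:)
  qed
  have "card {b \<in> B. \<exists>c\<in>B. s a c < s a b \<and> level A B s a b \<le> level A B s a c}
      \<le> card {x. \<exists>b\<in>B. \<exists>c\<in>B. ?f b < ?f c \<and> x \<notin> ?S b \<and> x \<in> ?S c}"
    unfolding eq
  proof (rule card_overtaken_le[of B ?f ?S])
    show "finite B" by fact
    show "inj_on ?f B" using inj by (auto simp: inj_on_def)
    show "finite (?S b)" for b using fin by simp
    fix x b1 b2 b3
    assume b: "b1 \<in> B" "b2 \<in> B" "b3 \<in> B" "?f b1 < ?f b2" "?f b2 < ?f b3" "x \<notin> ?S b1" "x \<in> ?S b2"
    then have "x \<in> A" by simp
    then obtain C D where CD: "\<And>b. b \<in> B \<Longrightarrow> s x b > s a b \<longleftrightarrow> D < C * s a b"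
      using thr a unfolding row_threshold_def by meson
    \<comment> \<open>Having entered, \<open>x\<close> stays: the comparison with the threshold cannot flip back.\<close>
    have "\<not> s x b1 > s a b1" "s x b2 > s a b2" using b(6,7) \<open>x \<in> A\<close> by simp_all
    then have 1: "C * s a b1 \<le> D" "D < C * s a b2" using CD[OF b(1)] CD[OF b(2)] by linarith+
    then have "C * (s a b1 - s a b2) < 0" by (simp add: algebra_simps)
    moreover have "s a b1 - s a b2 > 0" using b(4) by simp
    ultimately have "C < 0" by (simp add: mult_less_0_iff)
    moreover have "s a b3 \<le> s a b2" using b(5) by simp
    ultimately have "C * s a b2 \<le> C * s a b3" by (intro mult_left_mono_neg) simp_all
    then have "D < C * s a b3" using 1 by linarith
    then have "s x b3 > s a b3" using CD[OF b(3)] by blast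
    then show "x \<in> ?S b3" using \<open>x \<in> A\<close> by blast
  qed
  also have "\<dots> \<le> card (switching A B s `` {a})"
  proof (rule card_mono)
    show "finite (switching A B s `` {a})"
      by (rule finite_subset[OF _ fin(1)]) (unfold switching_def, blast)
    show "{x. \<exists>b\<in>B. \<exists>c\<in>B. ?f b < ?f c \<and> x \<notin> ?S b \<and> x \<in> ?S c} \<subseteq> switching A B s `` {a}"
    proof
      fix x assume "x \<in> {x. \<exists>b\<in>B. \<exists>c\<in>B. ?f b < ?f c \<and> x \<notin> ?S b \<and> x \<in> ?S c}"
      then obtain b c where h: "b \<in> B" "c \<in> B" "\<not> s a b < s x b" "x \<in> A" "s a c < s x c"
        by blast
      then have "s x b \<noteq> s a b" using inj_onD[OF col_inj[of b], of x a] a by auto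
      then have "s x b < s a b" using h(3) by simp
      then show "x \<in> switching A B s `` {a}"
        using h a unfolding switching_def by blast
    qed
  qed
  finally show ?thesis .
qed


lemma card_Sigma_switching:
  assumes "finite A"
  shows "(\<Sum>a\<in>A. card (switching A B s `` {a})) = card (switching A B s)"
proof -
  have "switching A B s = (SIGMA a:A. switching A B s `` {a})"
    by (auto simp: switching_def)
  moreover have "card (SIGMA a:A. switching A B s `` {a}) = (\<Sum>a\<in>A. card (switching A B s `` {a}))"
    using assms by (intro card_SigmaI) (auto simp: switching_def)
  ultimately show ?thesis by simp
qed

text \<open>The entries whose level fails to exceed that of some later, that is smaller, entry of the row. Negating
  and transposing \<open>s\<close> gives the three analogous failures, for earlier entries and for columns.\<close>

definition late_in_row :: "'a set \<Rightarrow> 'b set \<Rightarrow> ('a \<Rightarrow> 'b \<Rightarrow> real) \<Rightarrow> ('a \<times> 'b) set" where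
  "late_in_row A B s = (SIGMA a:A. {b \<in> B. \<exists>c\<in>B. s a c < s a b \<and> level A B s a b \<le> level A B s a c})"

lemma card_late_in_row_le:
  assumes fin: "finite A" "finite B"
    and inj: "\<And>a. a \<in> A \<Longrightarrow> inj_on (s a) B" and col_inj: "\<And>b. b \<in> B \<Longrightarrow> inj_on (\<lambda>a. s a b) A"
    and thr: "row_threshold A B s"
  shows "card (late_in_row A B s) \<le> card (switching A B s)"
proof -
  have "card (late_in_row A B s) =
      (\<Sum>a\<in>A. card {b \<in> B. \<exists>c\<in>B. s a c < s a b \<and> level A B s a b \<le> level A B s a c})"
    unfolding late_in_row_def using fin by (intro card_SigmaI) auto
  also have "\<dots> \<le> (\<Sum>a\<in>A. card (switching A B s `` {a}))"
    by (intro sum_mono card_row_late_le) (use assms in auto)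
  finally show ?thesis using card_Sigma_switching[OF fin(1), of B s] by simp
qed

text \<open>Call an entry good if the level is strictly monotone at it: in its row the level is larger at larger
  entries and smaller at smaller ones, in its column it is the other way round. At most twice as
  many entries as there are switching pairs, of rows and of columns, are not good. Any two good entries \<open>(a, b)\<close> and \<open>(c, d)\<close> of the same level
  \<open>w\<close> cross. For let \<open>s c d < s a b\<close> and suppose, say, that \<open>s a d < s c d\<close>. Then \<open>(a, d)\<close> comes after
  \<open>(a, b)\<close> in row \<open>a\<close>, so its level is below \<open>w\<close>; but it also comes after \<open>(c, d)\<close> in column \<open>d\<close>, so its
  level is above \<open>w\<close>. The other three comparisons are alike. There are at most
  \<open>card A + card B\<close> levels, and the most popular one gives the family.\<close>

lemma exists_crossing_entries:
  fixes s :: "'a \<Rightarrow> 'b \<Rightarrow> real"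
  assumes fin: "finite A" "finite B"
    and row_inj: "\<And>a. a \<in> A \<Longrightarrow> inj_on (s a) B" and col_inj: "\<And>b. b \<in> B \<Longrightarrow> inj_on (\<lambda>a. s a b) A"
    and row_thr: "row_threshold A B s" and col_thr: "row_threshold B A (\<lambda>b a. s a b)"
    and M: "M \<subseteq> A \<times> B"
  shows "\<exists>F\<subseteq>M. (\<forall>e\<in>F. \<forall>f\<in>F. e \<noteq> f \<longrightarrow> crossing_entries s e f \<or> crossing_entries s f e) \<and>
           card M \<le> card F * (card A + card B)
             + 2 * (card (switching A B s) + card (switching B A (\<lambda>b a. s a b)))"
proof -
  let ?t = "\<lambda>b a. s a b" and ?n = "\<lambda>a b. - s a b"
  let ?w = "\<lambda>e. level A B s (fst e) (snd e)"
  define R1 where "R1 = late_in_row A B s"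
  define R2 where "R2 = late_in_row A B ?n"
  define C1 where "C1 = prod.swap ` late_in_row B A ?t"
  define C2 where "C2 = prod.swap ` late_in_row B A (\<lambda>b a. - s a b)"
  define G where "G = M - (R1 \<union> R2 \<union> C1 \<union> C2)"
  have lev_n: "level A B ?n a b = int (card A) - int (card B) - level A B s a b"
    if "a \<in> A" "b \<in> B" for a b
    using that by (intro level_uminus fin row_inj col_inj)
  have lev_t: "level B A ?t b a = - level A B s a b" for a b by (rule level_transpose)
  have lev_tn: "level B A (\<lambda>b a. - s a b) b a = int (card B) - int (card A) + level A B s a b"
    if "a \<in> A" "b \<in> B" for a b
    using level_transpose[of B A ?n b a] lev_n[OF that] by simp
  have finM: "finite M" using fin M by (meson finite_SigmaI finite_subset)
  have R1c: "card R1 \<le> card (switching A B s)" unfolding R1_def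
    using assms by (intro card_late_in_row_le)
  have R2c: "card R2 \<le> card (switching A B s)" unfolding R2_def
    using card_late_in_row_le[of A B ?n] assms
    by (simp add: switching_uminus row_threshold_uminus inj_on_def)
  have swap: "card (prod.swap ` X) = card X" for X :: "('b \<times> 'a) set"
    by (intro card_image) (auto simp: inj_on_def)
  have C1c: "card C1 \<le> card (switching B A ?t)" unfolding C1_def swap
    using assms by (intro card_late_in_row_le)
  have C2c: "card C2 \<le> card (switching B A ?t)" unfolding C2_def swap
    using card_late_in_row_le[of B A "\<lambda>b a. - s a b"] assms
      switching_uminus[of B A ?t] row_threshold_uminus[of B A ?t] by (simp add: inj_on_def)
  have finbad: "finite R1" "finite R2" "finite C1" "finite C2"
    unfolding R1_def R2_def C1_def C2_def late_in_row_def using fin by auto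
  have "card M \<le> card (G \<union> (R1 \<union> R2 \<union> C1 \<union> C2))"
    by (intro card_mono) (use finM finbad in \<open>auto simp: G_def\<close>)
  also have "\<dots> \<le> card G + (card R1 + card R2 + card C1 + card C2)"
    using card_Un_le[of G "R1 \<union> R2 \<union> C1 \<union> C2"] card_Un_le[of "R1 \<union> R2 \<union> C1" C2]
      card_Un_le[of "R1 \<union> R2" C1] card_Un_le[of R1 R2] by linarith
  finally have "card M \<le> card G + (card R1 + card R2 + card C1 + card C2)" .
  then have cardM: "card M \<le> card G + 2 * (card (switching A B s) + card (switching B A ?t))"
    using R1c R2c C1c C2c by (simp only: mult_2)
  have row_dec: "level A B s a c < level A B s a b"
    if "(a, b) \<in> G" "c \<in> B" "s a c < s a b" for a b c
    using that M by (fastforce simp: G_def R1_def late_in_row_def)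
  have row_inc: "level A B s a b < level A B s a c"
    if g: "(a, b) \<in> G" "c \<in> B" "s a b < s a c" for a b c
  proof (rule ccontr)
    assume n: "\<not> ?thesis"
    have ab: "a \<in> A" "b \<in> B" using g(1) M by (auto simp: G_def)
    then have "(a, b) \<in> R2" using g n lev_n[of a b] lev_n[of a c]
      unfolding R2_def late_in_row_def by (auto intro!: bexI[of _ c])
    then show False using g(1) by (simp add: G_def)
  qed
  have col_inc: "level A B s a b < level A B s c b"
    if g: "(a, b) \<in> G" "c \<in> A" "s c b < s a b" for a b c
  proof (rule ccontr)
    assume n: "\<not> ?thesis"
    have ab: "a \<in> A" "b \<in> B" using g(1) M by (auto simp: G_def)
    then have "(b, a) \<in> late_in_row B A ?t" using g n lev_t
      unfolding late_in_row_def by (auto intro!: bexI[of _ c])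
    then have "(a, b) \<in> C1" unfolding C1_def by force
    then show False using g(1) by (simp add: G_def)
  qed
  have col_dec: "level A B s c b < level A B s a b"
    if g: "(a, b) \<in> G" "c \<in> A" "s a b < s c b" for a b c
  proof (rule ccontr)
    assume n: "\<not> ?thesis"
    have ab: "a \<in> A" "b \<in> B" using g(1) M by (auto simp: G_def)
    then have "(b, a) \<in> late_in_row B A (\<lambda>b a. - s a b)" using g n lev_tn[of a b] lev_tn[of c b]
      unfolding late_in_row_def by (auto intro!: bexI[of _ c])
    then have "(a, b) \<in> C2" unfolding C2_def by force
    then show False using g(1) by (simp add: G_def)
  qed
  have cross: "crossing_entries s e f"
    if ef: "e \<in> G" "f \<in> G" "?w e = ?w f" "s (fst f) (snd f) < s (fst e) (snd e)" for e f
  proof -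
    obtain a b c d where e: "e = (a, b)" and f: "f = (c, d)" by force
    have mem: "a \<in> A" "b \<in> B" "c \<in> A" "d \<in> B" using ef e f M by (auto simp: G_def)
    have G: "(a, b) \<in> G" "(c, d) \<in> G" and w: "level A B s a b = level A B s c d"
      and less: "s c d < s a b" using ef e f by auto
    have ac: "a \<noteq> c" using row_dec[OF G(1) mem(4)] w less by auto
    have bd: "b \<noteq> d" using col_inc[OF G(1) mem(3)] w less by auto
    have neq: "s a d \<noteq> s c d" "s c b \<noteq> s a b" "s a d \<noteq> s a b" "s c b \<noteq> s c d"
      using ac bd mem row_inj col_inj by (auto dest: inj_onD)
    have "s c d < s a d"
      using row_dec[OF G(1) mem(4)] col_inc[OF G(2) mem(1)] w less neq by force
    moreover have "s c b < s a b"
      using col_dec[OF G(1) mem(3)] row_inc[OF G(2) mem(2)] w less neq by force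
    moreover have "s a d < s a b"
      using row_inc[OF G(1) mem(4)] col_dec[OF G(2) mem(1)] w less neq by force
    moreover have "s c d < s c b"
      using row_dec[OF G(2) mem(2)] col_inc[OF G(1) mem(3)] w less neq by force
    ultimately show ?thesis by (simp add: crossing_entries_def e f)
  qed
  \<comment> \<open>Equal slopes are ruled out by the same contradiction at \<open>(a, d)\<close>.\<close>
  have tie: "s (fst e) (snd e) \<noteq> s (fst f) (snd f)"
    if ef: "e \<in> G" "f \<in> G" "?w e = ?w f" "e \<noteq> f" for e f
  proof
    assume eq: "s (fst e) (snd e) = s (fst f) (snd f)"
    obtain a b c d where e: "e = (a, b)" and f: "f = (c, d)" by force
    have mem: "a \<in> A" "b \<in> B" "c \<in> A" "d \<in> B" using ef e f M by (auto simp: G_def)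
    have G: "(a, b) \<in> G" "(c, d) \<in> G" and w: "level A B s a b = level A B s c d"
      using ef e f by auto
    have "s a d = s a b"
      using row_dec[OF G(1) mem(4)] col_inc[OF G(2) mem(1)]
        row_inc[OF G(1) mem(4)] col_dec[OF G(2) mem(1)] w eq e f by force
    moreover from this have "s a d = s c d" using eq e f by simp
    ultimately have "b = d" "a = c" using mem row_inj col_inj by (auto dest: inj_onD)
    then show False using ef e f by simp
  qed
  have cross': "crossing_entries s e f \<or> crossing_entries s f e"
    if "e \<in> G" "f \<in> G" "?w e = ?w f" "e \<noteq> f" for e f
    using cross[of e f] cross[of f e] tie[of e f] that by linarith
  let ?D = "{- int (card B)<..int (card A)}"
  have "\<exists>d. card G \<le> card {e \<in> G. ?w e = d} * (card A + card B)"
  proof (rule ccontr)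
    assume "\<not> ?thesis"
    then have small: "card {e \<in> G. ?w e = d} * (card A + card B) < card G" for d
      by (meson not_le)
    have finG: "finite G" using finM by (simp add: G_def)
    have wD: "?w ` G \<subseteq> ?D"
    proof clarify
      fix a b assume "(a, b) \<in> G"
      then have ab: "a \<in> A" "b \<in> B" using M by (auto simp: G_def)
      have "card {b' \<in> B. s a b' > s a b} < card B"
        by (intro psubset_card_mono fin) (use ab in auto)
      moreover have "card {a' \<in> A. s a' b > s a b} \<le> card A"
        by (intro card_mono fin) auto
      ultimately show "level A B s (fst (a, b)) (snd (a, b)) \<in> ?D"
        unfolding level_def by simp
    qed
    have "card G = (\<Sum>d\<in>?D. card {e \<in> G. ?w e = d})"
    proof -
      have "G = (\<Union>d\<in>?D. {e \<in> G. ?w e = d})" using wD by auto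
      then have "card G = card (\<Union>d\<in>?D. {e \<in> G. ?w e = d})" by simp
      also have "\<dots> = (\<Sum>d\<in>?D. card {e \<in> G. ?w e = d})"
        by (rule card_UN_disjoint) (use finG in auto)
      finally show ?thesis .
    qed
    then have "card G * (card A + card B) = (\<Sum>d\<in>?D. card {e \<in> G. ?w e = d} * (card A + card B))"
      by (simp add: sum_distrib_right)
    also have "\<dots> < (\<Sum>d\<in>?D. card G)"
    proof (rule sum_strict_mono)
      show "?D \<noteq> {}"
      proof
        assume "?D = {}"
        then have "card A = 0 \<and> card B = 0" by auto
        then have "G = {}" using fin M by (auto simp: G_def)
        then show False using small[of 0] by simp
      qed
    qed (use small in auto)
    also have "\<dots> = card G * (card A + card B)" by (simp add: nat_int_add)
    finally show False by simp
  qed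
  then obtain d where d: "card G \<le> card {e \<in> G. ?w e = d} * (card A + card B)" by blast
  show ?thesis
  proof (intro exI[of _ "{e \<in> G. ?w e = d}"] conjI ballI impI)
    show "{e \<in> G. ?w e = d} \<subseteq> M" by (auto simp: G_def)
    show "card M \<le> card {e \<in> G. ?w e = d} * (card A + card B)
        + 2 * (card (switching A B s) + card (switching B A ?t))"
      using cardM d by linarith
  qed (use cross' in auto)
qed

section \<open>Crossing segments between separated point sets\<close>

definition orient :: "point \<Rightarrow> point \<Rightarrow> point \<Rightarrow> real" where
  "orient p q r = (q $ 1 - p $ 1) * (r $ 2 - p $ 2) - (r $ 1 - p $ 1) * (q $ 2 - p $ 2)"

definition splits :: "point \<Rightarrow> point \<Rightarrow> point set \<Rightarrow> bool" where
  "splits p q Q \<longleftrightarrow> (\<exists>r\<in>Q. orient p q r < 0) \<and> (\<exists>r\<in>Q. orient p q r > 0)"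

definition separated :: "point set \<Rightarrow> point set \<Rightarrow> bool" where
  "separated A B \<longleftrightarrow> (\<exists>w. \<forall>a\<in>A. \<forall>b\<in>B. w \<bullet> a < w \<bullet> b)"

lemma orient_cyclic: "orient p q r = orient q r p"
  by (simp add: orient_def algebra_simps)

lemma orient_flip: "orient p q r = - orient p r q"
  by (simp add: orient_def algebra_simps)

lemma inner_point: "x \<bullet> y = x $ 1 * y $ 1 + x $ 2 * (y $ 2 :: real)" for x y :: point
  by (simp add: inner_vec_def sum_2)

lemma collinear_if_orient_zero:
  assumes "p \<noteq> q" "orient p q r = 0"
  shows "collinear {p, q, r}"
proof -
  have "q $ 1 \<noteq> p $ 1 \<or> q $ 2 \<noteq> p $ 2"
    using assms(1) by (auto simp: vec_eq_iff forall_2)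
  then have "\<exists>u. r = u *\<^sub>R q + (1 - u) *\<^sub>R p"
  proof
    assume ne: "q $ 1 \<noteq> p $ 1"
    have "r = ((r $ 1 - p $ 1) / (q $ 1 - p $ 1)) *\<^sub>R q + (1 - (r $ 1 - p $ 1) / (q $ 1 - p $ 1)) *\<^sub>R p"
      using ne assms(2) unfolding orient_def vec_eq_iff forall_2
      by (simp add: divide_simps) (auto simp: algebra_simps)
    then show ?thesis by blast
  next
    assume ne: "q $ 2 \<noteq> p $ 2"
    have "r = ((r $ 2 - p $ 2) / (q $ 2 - p $ 2)) *\<^sub>R q + (1 - (r $ 2 - p $ 2) / (q $ 2 - p $ 2)) *\<^sub>R p"
      using ne assms(2) unfolding orient_def vec_eq_iff forall_2
      by (simp add: divide_simps) (auto simp: algebra_simps)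
    then show ?thesis by blast
  qed
  then have "collinear {q, r, p}" by (simp add: collinear_3_expand)
  then show ?thesis by (simp add: insert_commute)
qed

lemma general_position_orient:
  assumes "general_position V" "p \<in> V" "q \<in> V" "r \<in> V" "p \<noteq> q" "q \<noteq> r" "p \<noteq> r"
  shows "orient p q r \<noteq> 0"
proof
  assume "orient p q r = 0"
  then have "collinear {p, q, r}" using collinear_if_orient_zero assms by blast
  moreover have "card {p, q, r} = 3" using assms by simp
  moreover have "{p, q, r} \<subseteq> V" using assms by simp
  ultimately show False using assms(1) unfolding general_position_def by blast
qed

text \<open>The point that divides the first segment in the ratio of the distances of its endpoints from the second
  line equals the point obtained with the roles exchanged, and the sign conditions place both inside.\<close>

lemma segments_crossI:
  assumes "orient a b c * orient a b d < 0" "orient c d a * orient c d b < 0"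
  shows "segments_cross {a, b} {c, d}"
proof -
  have frac: "0 < x / (x - y) \<and> x / (x - y) < 1" if "x * y < 0" for x y :: real
  proof (cases "x > 0")
    case True
    then have "y < 0" using that by (simp add: mult_less_0_iff)
    then show ?thesis using True by simp
  next
    case False
    then have "x < 0" "y > 0" using that by (auto simp: mult_less_0_iff)
    then show ?thesis by (simp add: divide_simps)
  qed
  define t where "t = orient c d a / (orient c d a - orient c d b)"
  define u where "u = orient a b c / (orient a b c - orient a b d)"
  have t: "0 < t" "t < 1" using frac[OF assms(2)] by (auto simp: t_def)
  have u: "0 < u" "u < 1" using frac[OF assms(1)] by (auto simp: u_def)
  have ab: "a \<noteq> b" and cd: "c \<noteq> d" using assms by (auto simp: orient_def)
  have ne: "orient c d a - orient c d b \<noteq> 0" "orient a b c - orient a b d \<noteq> 0"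
    using assms by (auto simp: mult_less_0_iff)
  have eq: "orient a b c - orient a b d = - (orient c d a - orient c d b)"
    by (simp add: orient_def algebra_simps)
  have tne: "t * (orient c d a - orient c d b) = orient c d a" using ne by (simp add: t_def)
  have une: "u * (orient c d a - orient c d b) = - orient a b c"
    unfolding u_def eq using ne(1) by (simp add: divide_simps) (simp add: algebra_simps)
  have "((1 - t) *\<^sub>R a + t *\<^sub>R b) $ i = ((1 - u) *\<^sub>R c + u *\<^sub>R d) $ i" for i
  proof -
    let ?k = "orient c d a - orient c d b"
    have "?k * ((1 - t) *\<^sub>R a + t *\<^sub>R b) $ i = ?k * a $ i + (t * ?k) * (b $ i - a $ i)"
      by (simp add: algebra_simps)
    also have "\<dots> = ?k * c $ i + (u * ?k) * (d $ i - c $ i)"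
      unfolding tne une using exhaust_2[of i]
      by (auto simp: orient_def algebra_simps)
    also have "\<dots> = ?k * ((1 - u) *\<^sub>R c + u *\<^sub>R d) $ i"
      by (simp add: algebra_simps)
    finally show ?thesis using ne(1) by simp
  qed
  then have "(1 - t) *\<^sub>R a + t *\<^sub>R b = (1 - u) *\<^sub>R c + u *\<^sub>R d" by (simp add: vec_eq_iff)
  moreover have "(1 - t) *\<^sub>R a + t *\<^sub>R b \<in> open_segment a b"
    using t ab by (auto simp: in_segment)
  moreover have "(1 - u) *\<^sub>R c + u *\<^sub>R d \<in> open_segment c d"
    using u cd by (auto simp: in_segment)
  moreover have "rel_interior (convex hull {a, b}) = open_segment a b"
    "rel_interior (convex hull {c, d}) = open_segment c d"
    using ab cd by (simp_all add: segment_convex_hull[symmetric] rel_interior_closed_segment)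
  ultimately show ?thesis unfolding segments_cross_def by auto
qed

lemma segments_cross_sym: "segments_cross e f \<Longrightarrow> segments_cross f e"
  by (auto simp: segments_cross_def)

text \<open>If \<open>w\<close> separates \<open>A\<close> from \<open>B\<close>, then \<open>w \<bullet> p\<close> and \<open>cross w p\<close> are orthogonal coordinates of \<open>p\<close> in which
  \<open>A\<close> lies to the left of \<open>B\<close>; slopes are taken in these coordinates, so that no line through a point
  of \<open>A\<close> and a point of \<open>B\<close> is vertical.\<close>

definition cross :: "point \<Rightarrow> point \<Rightarrow> real" where
  "cross w p = w $ 1 * p $ 2 - w $ 2 * p $ 1"

definition slope :: "point \<Rightarrow> point \<Rightarrow> point \<Rightarrow> real" where
  "slope w p q = (cross w q - cross w p) / (w \<bullet> q - w \<bullet> p)"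

lemma orient_in_frame:
  "(w \<bullet> q - w \<bullet> p) * (cross w r - cross w p) - (w \<bullet> r - w \<bullet> p) * (cross w q - cross w p)
     = (w \<bullet> w) * orient p q r"
  by (simp add: orient_def cross_def inner_point algebra_simps)

lemma slope_less_right:
  assumes "w \<bullet> a < w \<bullet> b" "w \<bullet> a < w \<bullet> b'"
  shows "slope w a b' < slope w a b \<longleftrightarrow> orient a b b' < 0"
    and "slope w a b' = slope w a b \<longleftrightarrow> orient a b b' = 0"
proof -
  have w: "w \<bullet> w > 0" using assms by auto
  let ?d = "(w \<bullet> b - w \<bullet> a) * (cross w b' - cross w a) - (w \<bullet> b' - w \<bullet> a) * (cross w b - cross w a)"
  have "slope w a b' < slope w a b \<longleftrightarrow> ?d < 0" "slope w a b' = slope w a b \<longleftrightarrow> ?d = 0"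
    using assms by (simp_all add: slope_def frac_less_eq divide_simps mult.commute)
  then show "slope w a b' < slope w a b \<longleftrightarrow> orient a b b' < 0"
    "slope w a b' = slope w a b \<longleftrightarrow> orient a b b' = 0"
    unfolding orient_in_frame using w by (simp_all add: mult_less_0_iff)
qed

lemma slope_commute: "slope w p q = slope w q p"
proof -
  have "slope w q p = (- (cross w q - cross w p)) / (- (w \<bullet> q - w \<bullet> p))"
    by (simp add: slope_def)
  then show ?thesis unfolding slope_def minus_divide_divide by simp
qed

text \<open>Turning the plane by half a turn exchanges left and right and keeps slopes. Facts about \<open>A\<close> on the left
  thus give the corresponding facts about \<open>B\<close>.\<close>

lemma slope_uminus: "slope (- w) p q = slope w p q"
proof -
  have "slope (- w) p q = (- (cross w q - cross w p)) / (- (w \<bullet> q - w \<bullet> p))"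
    by (simp add: slope_def cross_def algebra_simps)
  then show ?thesis unfolding slope_def minus_divide_divide by simp
qed

lemma row_threshold_slope:
  assumes "\<forall>a\<in>A. \<forall>b\<in>B. w \<bullet> a < w \<bullet> b"
  shows "row_threshold A B (slope w)"
  unfolding row_threshold_def
proof (intro ballI)
  fix a a' assume a: "a \<in> A" "a' \<in> A"
  let ?C = "w \<bullet> a' - w \<bullet> a" and ?D = "cross w a' - cross w a"
  have "(slope w a' b > slope w a b \<longleftrightarrow> ?D < ?C * slope w a b) \<and>
        (slope w a' b < slope w a b \<longleftrightarrow> ?D > ?C * slope w a b)" if "b \<in> B" for b
  proof -
    have pos: "w \<bullet> b - w \<bullet> a > 0" "w \<bullet> b - w \<bullet> a' > 0" using assms a that by auto
    have "slope w a b * (w \<bullet> b - w \<bullet> a) = cross w b - cross w a" using pos by (simp add: slope_def)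
    then show ?thesis using pos
      by (subst (1 3) slope_def) (auto simp: pos_less_divide_eq pos_divide_less_eq algebra_simps)
  qed
  then show "\<exists>C D. \<forall>b\<in>B. (slope w a' b > slope w a b \<longleftrightarrow> D < C * slope w a b) \<and>
        (slope w a' b < slope w a b \<longleftrightarrow> D > C * slope w a b)" by blast
qed

lemma switching_slope_subset:
  assumes "\<forall>a\<in>A. \<forall>b\<in>B. w \<bullet> a < w \<bullet> b"
  shows "switching A B (slope w) \<subseteq> {(a, a') \<in> A \<times> A. splits a a' B}"
proof -
  have less: "slope w a' b < slope w a b \<longleftrightarrow> orient a a' b < 0"
    if "a \<in> A" "a' \<in> A" "b \<in> B" for a a' b
  proof -
    have "(- w) \<bullet> b < (- w) \<bullet> a" "(- w) \<bullet> b < (- w) \<bullet> a'" using assms that by auto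
    from slope_less_right(1)[OF this] show ?thesis
      using orient_cyclic[of b a a'] by (simp add: slope_uminus slope_commute[of w b])
  qed
  have greater: "slope w a b < slope w a' b \<longleftrightarrow> orient a a' b > 0"
    if "a \<in> A" "a' \<in> A" "b \<in> B" for a a' b
    using less[OF that(2,1,3)] orient_cyclic[of a' a b] orient_flip[of a b a'] by simp
  show ?thesis unfolding switching_def splits_def using less greater by blast
qed

text \<open>The matrix argument, applied to slopes: two entries that cross are segments that cross.\<close>

theorem exists_crossing_between_separated:
  assumes gp: "general_position V" and AB: "A \<subseteq> V" "B \<subseteq> V" "finite A" "finite B"
    and sep: "separated A B" and M: "M \<subseteq> A \<times> B"
  shows "\<exists>F\<subseteq>M. (\<forall>e\<in>F. \<forall>f\<in>F. e \<noteq> f \<longrightarrow> segments_cross {fst e, snd e} {fst f, snd f}) \<and>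
      card M \<le> card F * (card A + card B)
        + 2 * (card {(a, a') \<in> A \<times> A. splits a a' B} + card {(b, b') \<in> B \<times> B. splits b b' A})"
proof -
  obtain w where w: "\<forall>a\<in>A. \<forall>b\<in>B. w \<bullet> a < w \<bullet> b" using sep by (auto simp: separated_def)
  let ?s = "slope w"
  have w': "\<forall>b\<in>B. \<forall>a\<in>A. (- w) \<bullet> b < (- w) \<bullet> a" using w by auto
  have t: "(\<lambda>b a. slope w a b) = slope (- w)"
    by (intro ext) (simp add: slope_uminus slope_commute)
  have row: "inj_on (slope w a) B" if "a \<in> A" for a
  proof (rule inj_onI, rule ccontr)
    fix b b' assume b: "b \<in> B" "b' \<in> B" "slope w a b = slope w a b'" "b \<noteq> b'"
    then have "orient a b b' = 0" using slope_less_right(2)[of w a b b'] w that by auto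
    moreover have "a \<noteq> b" "a \<noteq> b'" using w that b by auto
    ultimately show False using general_position_orient[OF gp, of a b b'] that b AB by auto
  qed
  have col: "inj_on (\<lambda>a. slope w a b) A" if "b \<in> B" for b
  proof (rule inj_onI, rule ccontr)
    fix a a' assume a: "a \<in> A" "a' \<in> A" "slope w a b = slope w a' b" "a \<noteq> a'"
    then have "orient b a a' = 0"
      using slope_less_right(2)[of "- w" b a a'] w' that by (simp add: slope_uminus slope_commute[of w b])
    moreover have "b \<noteq> a" "b \<noteq> a'" using w that a by auto
    ultimately show False using general_position_orient[OF gp, of b a a'] that a AB by auto
  qed
  have col_thr: "row_threshold B A (\<lambda>b a. slope w a b)"
    unfolding t by (rule row_threshold_slope[OF w'])
  obtain F where F: "F \<subseteq> M"
    "\<And>e f. e \<in> F \<Longrightarrow> f \<in> F \<Longrightarrow> e \<noteq> f \<Longrightarrow> crossing_entries ?s e f \<or> crossing_entries ?s f e"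
    and card: "card M \<le> card F * (card A + card B)
             + 2 * (card (switching A B ?s) + card (switching B A (\<lambda>b a. ?s a b)))"
    using exists_crossing_entries[OF AB(3,4) row col row_threshold_slope[OF w] col_thr M] by blast
  have seg: "segments_cross {fst e, snd e} {fst f, snd f}"
    if "e \<in> M" "f \<in> M" "crossing_entries ?s e f" for e f
  proof -
    obtain a b c d where e: "e = (a, b)" and f: "f = (c, d)" by force
    have mem: "a \<in> A" "b \<in> B" "c \<in> A" "d \<in> B" using that e f M by auto
    have s: "?s a d < ?s a b" "?s c b < ?s a b" "?s c d < ?s a d" "?s c d < ?s c b"
      using that(3) by (auto simp: crossing_entries_def e f)
    have l: "w \<bullet> a < w \<bullet> b" "w \<bullet> a < w \<bullet> d" "w \<bullet> c < w \<bullet> b" "w \<bullet> c < w \<bullet> d" using w mem by auto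
    have l': "(-w) \<bullet> b < (-w) \<bullet> a" "(-w) \<bullet> d < (-w) \<bullet> a" "(-w) \<bullet> b < (-w) \<bullet> c" "(-w) \<bullet> d < (-w) \<bullet> c"
      using l by auto
    have "orient a b d < 0" using slope_less_right(1)[OF l(1,2)] s by simp
    moreover have "orient c b d < 0" using slope_less_right(1)[OF l(3,4)] s by simp
    moreover have "orient b a c < 0"
      using slope_less_right(1)[OF l'(1,3)] s by (simp add: slope_uminus slope_commute[of w b])
    moreover have "orient d a c < 0"
      using slope_less_right(1)[OF l'(2,4)] s by (simp add: slope_uminus slope_commute[of w d])
    ultimately have "orient a b c > 0" "orient a b d < 0" "orient c d a < 0" "orient c d b > 0"
      using orient_flip[of a b c] orient_cyclic[of b a c] orient_cyclic[of c d a]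
        orient_flip[of c d b] by linarith+
    then show ?thesis unfolding e f fst_conv snd_conv
      by (intro segments_crossI) (auto simp: mult_less_0_iff)
  qed
  have fin: "finite {(a, a') \<in> A \<times> A. splits a a' B}" "finite {(b, b') \<in> B \<times> B. splits b b' A}"
    using AB by (auto intro: finite_subset[of _ "A \<times> A"] finite_subset[of _ "B \<times> B"])
  have "card (switching A B ?s) \<le> card {(a, a') \<in> A \<times> A. splits a a' B}"
    by (intro card_mono fin switching_slope_subset w)
  moreover have "card (switching B A (\<lambda>b a. ?s a b)) \<le> card {(b, b') \<in> B \<times> B. splits b b' A}"
    unfolding t by (intro card_mono fin switching_slope_subset w')
  ultimately have "card M \<le> card F * (card A + card B)
        + 2 * (card {(a, a') \<in> A \<times> A. splits a a' B} + card {(b, b') \<in> B \<times> B. splits b b' A})"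
    using card by (meson add_left_mono add_mono le_trans mult_le_mono2)
  moreover have "segments_cross {fst e, snd e} {fst f, snd f}" if "e \<in> F" "f \<in> F" "e \<noteq> f" for e f
    using F(2)[OF that] seg[of e f] seg[of f e] F(1) that segments_cross_sym by blast
  ultimately show ?thesis using F(1) by blast
qed

section \<open>Partitions that few lines split\<close>

lemma separated_sym: "separated A B \<Longrightarrow> separated B A"
  unfolding separated_def by (metis inner_minus_left neg_less_iff_less)

lemma separated_mono: "separated A B \<Longrightarrow> A' \<subseteq> A \<Longrightarrow> B' \<subseteq> B \<Longrightarrow> separated A' B'"
  unfolding separated_def by blast

lemma separated_disjoint: "separated A B \<Longrightarrow> A \<inter> B = {}"
  unfolding separated_def by force

lemma splits_mono: "splits p q A \<Longrightarrow> A \<subseteq> B \<Longrightarrow> splits p q B"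
  unfolding splits_def by blast

definition kth_least :: "nat \<Rightarrow> 'a set \<Rightarrow> ('a \<Rightarrow> real) \<Rightarrow> real" where
  "kth_least k L z = Min ((\<lambda>T. Max (z ` T)) ` {T. T \<subseteq> L \<and> card T = k})"

text \<open>As a minimum of maxima the order statistic is visibly continuous, and a set of \<open>k\<close> points below it would
  have a smaller maximum.\<close>

lemma kth_least:
  assumes L: "finite L" and k: "1 \<le> k" "k \<le> card L"
  shows "card {p \<in> L. z p < kth_least k L z} < k"
    and "k \<le> card {p \<in> L. z p \<le> kth_least k L z}"
    and "kth_least k L z \<in> z ` L"
proof -
  let ?F = "{T. T \<subseteq> L \<and> card T = k}"
  have fin: "finite ?F" using L by simp
  have ne: "?F \<noteq> {}" using obtain_subset_with_card_n[OF k(2)] by blast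
  have T: "finite T" "T \<noteq> {}" if "T \<in> ?F" for T
    using that L k finite_subset by auto
  have "kth_least k L z \<in> (\<lambda>T. Max (z ` T)) ` ?F"
    unfolding kth_least_def using fin ne by (intro Min_in) auto
  then obtain T where TF: "T \<in> ?F" and max: "kth_least k L z = Max (z ` T)" by blast
  have "Max (z ` T) \<in> z ` T" using T[OF TF] by (intro Max_in) auto
  then show "kth_least k L z \<in> z ` L" using TF max by auto
  have "T \<subseteq> {p \<in> L. z p \<le> kth_least k L z}"
    using TF T[OF TF] by (auto simp: max)
  then have "card T \<le> card {p \<in> L. z p \<le> kth_least k L z}"
    by (intro card_mono) (use L in auto)
  then show "k \<le> card {p \<in> L. z p \<le> kth_least k L z}" using TF by simp
  show "card {p \<in> L. z p < kth_least k L z} < k"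
  proof (rule ccontr)
    assume "\<not> ?thesis"
    then obtain T' where T': "T' \<subseteq> {p \<in> L. z p < kth_least k L z}" "card T' = k"
      by (meson not_less obtain_subset_with_card_n)
    then have F: "T' \<in> ?F" by auto
    then have "kth_least k L z \<le> Max (z ` T')"
      unfolding kth_least_def using fin by (intro Min_le) auto
    moreover have "Max (z ` T') < kth_least k L z"
      using T[OF F] T'(1) by auto
    ultimately show False by simp
  qed
qed

lemma continuous_on_Max:
  fixes f :: "'i \<Rightarrow> 'a::topological_space \<Rightarrow> real"
  assumes "finite I" "I \<noteq> {}" "\<And>i. i \<in> I \<Longrightarrow> continuous_on S (f i)"
  shows "continuous_on S (\<lambda>x. Max ((\<lambda>i. f i x) ` I))"
  using assms
proof (induction I rule: finite_ne_induct)
  case (insert i I)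
  have "Max ((\<lambda>i. f i x) ` insert i I) = max (f i x) (Max ((\<lambda>i. f i x) ` I))" for x
    using insert.hyps by simp
  then show ?case using insert by (auto intro!: continuous_on_max)
qed simp

lemma continuous_on_Min:
  fixes f :: "'i \<Rightarrow> 'a::topological_space \<Rightarrow> real"
  assumes "finite I" "I \<noteq> {}" "\<And>i. i \<in> I \<Longrightarrow> continuous_on S (f i)"
  shows "continuous_on S (\<lambda>x. Min ((\<lambda>i. f i x) ` I))"
  using assms
proof (induction I rule: finite_ne_induct)
  case (insert i I)
  have "Min ((\<lambda>i. f i x) ` insert i I) = min (f i x) (Min ((\<lambda>i. f i x) ` I))" for x
    using insert.hyps by simp
  then show ?case using insert by (auto intro!: continuous_on_min)
qed simp

lemma continuous_on_kth_least:
  fixes f :: "'p \<Rightarrow> real \<Rightarrow> real"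
  assumes L: "finite L" and k: "1 \<le> k" "k \<le> card L"
    and f: "\<And>p. p \<in> L \<Longrightarrow> continuous_on S (f p)"
  shows "continuous_on S (\<lambda>x. kth_least k L (\<lambda>p. f p x))"
  unfolding kth_least_def
proof (intro continuous_on_Min continuous_on_Max)
  show "finite {T. T \<subseteq> L \<and> card T = k}" using L by simp
  show "{T. T \<subseteq> L \<and> card T = k} \<noteq> {}" using obtain_subset_with_card_n[OF k(2)] by blast
  fix T assume T: "T \<in> {T. T \<subseteq> L \<and> card T = k}"
  show "finite T" using T L finite_subset by auto
  show "T \<noteq> {}" using T k by auto
  show "continuous_on S (f p)" if "p \<in> T" for p using f T that by auto
qed

text \<open>The discrete ham-sandwich theorem for two sets that lie on either side of a vertical line. For each slope
  \<open>m\<close> take the line of slope \<open>m\<close> that cuts off \<open>k\<close> points of \<open>L\<close>, and the one that cuts off \<open>k\<close> points of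
  \<open>R\<close>. For steep negative \<open>m\<close> all of \<open>L\<close> lies, in direction \<open>m\<close>, below all of \<open>R\<close>, for steep positive \<open>m\<close>
  above it, so the two lines coincide for some \<open>m\<close> in between.\<close>

lemma exists_bisecting_line:
  fixes X Y :: "'p \<Rightarrow> real"
  assumes L: "finite L" and R: "finite R" and LR: "\<And>p q. p \<in> L \<Longrightarrow> q \<in> R \<Longrightarrow> X p < X q"
    and k: "1 \<le> k" "k \<le> card L" "k \<le> card R"
  obtains m c where
    "card {p \<in> L. Y p - m * X p < c} < k" "k \<le> card {p \<in> L. Y p - m * X p \<le> c}"
    "card {p \<in> R. Y p - m * X p < c} < k" "k \<le> card {p \<in> R. Y p - m * X p \<le> c}"
proof -
  define z where "z m p = Y p - m * X p" for m p
  define D where "D m = kth_least k L (z m) - kth_least k R (z m)" for m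
  define r where "r e = \<bar>Y (snd e) - Y (fst e)\<bar> / (X (snd e) - X (fst e))" for e
  define M where "M = 1 + (\<Sum>e\<in>L \<times> R. r e)"
  have r0: "0 \<le> r e" if "e \<in> L \<times> R" for e
    using that LR by (auto simp: r_def less_imp_le intro!: divide_nonneg_nonneg)
  have M: "\<bar>Y q - Y p\<bar> < M * (X q - X p)" if "p \<in> L" "q \<in> R" for p q
  proof -
    have "r (p, q) \<le> (\<Sum>e\<in>L \<times> R. r e)"
      using that L R r0 by (intro member_le_sum) auto
    then have "r (p, q) < M" by (simp add: M_def)
    then show ?thesis using LR[OF that] by (simp add: r_def divide_less_eq)
  qed
  have memL: "kth_least k L (z m) \<in> z m ` L" and memR: "kth_least k R (z m) \<in> z m ` R" for m
    using kth_least(3) L R k by auto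
  have "D (- M) \<le> 0"
  proof -
    obtain p q where "p \<in> L" "q \<in> R" "kth_least k L (z (- M)) = z (- M) p"
      "kth_least k R (z (- M)) = z (- M) q" using memL memR by (metis imageE)
    then show ?thesis using M[of p q] by (simp add: D_def z_def algebra_simps)
  qed
  moreover have "0 \<le> D M"
  proof -
    obtain p q where "p \<in> L" "q \<in> R" "kth_least k L (z M) = z M p"
      "kth_least k R (z M) = z M q" using memL memR by (metis imageE)
    then show ?thesis using M[of p q] by (simp add: D_def z_def algebra_simps)
  qed
  moreover have "- M \<le> M"
    using r0 sum_nonneg[of "L \<times> R" r] by (simp add: M_def)
  moreover have "continuous_on {- M..M} D"
  proof -
    have "continuous_on {- M..M} (\<lambda>m. z m p)" for p
      unfolding z_def by (intro continuous_intros)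
    then show ?thesis unfolding D_def
      using L R k by (intro continuous_on_diff continuous_on_kth_least) auto
  qed
  ultimately obtain m where "D m = 0" using IVT'[of D "- M" 0 M] by auto
  then have eq: "kth_least k R (z m) = kth_least k L (z m)" by (simp add: D_def)
  show thesis
    using that[of m "kth_least k L (z m)"] kth_least(1,2)[OF L k(1,2), of "z m"]
      kth_least(1,2)[OF R k(1,3), of "z m"] unfolding eq by (simp add: z_def)
qed

lemma exists_initial_subset:
  fixes X :: "'p \<Rightarrow> real"
  assumes "finite P" "inj_on X P" "n \<le> card P"
  shows "\<exists>L\<subseteq>P. card L = n \<and> (\<forall>p\<in>L. \<forall>q\<in>P - L. X p < X q)"
  using assms(3)
proof (induction n)
  case 0
  then show ?case by (intro exI[of _ "{}"]) auto
next
  case (Suc n)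
  then obtain L where L: "L \<subseteq> P" "card L = n" "\<And>p q. p \<in> L \<Longrightarrow> q \<in> P - L \<Longrightarrow> X p < X q" by auto
  have "L \<noteq> P" using L Suc by auto
  then have ne: "P - L \<noteq> {}" using L by auto
  obtain x where x: "x \<in> P - L" "\<And>y. y \<in> P - L \<Longrightarrow> \<not> X y < X x"
    using arg_min_if_finite[of "P - L" X] ne assms(1) by (metis finite_Diff)
  have "X x < X y" if "y \<in> P - insert x L" for y
    using x(2)[of y] inj_onD[OF assms(2), of x y] that x(1) by fastforce
  moreover have "card (insert x L) = Suc n"
    using x L assms(1) finite_subset by fastforce
  ultimately show ?case using L x by (intro exI[of _ "insert x L"]) auto
qed

text \<open>Almost every direction separates finitely many points, which makes a cut by a vertical line exact.\<close>

lemma exists_injective_shear: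
  fixes P :: "point set"
  assumes "finite P"
  obtains t where "inj_on (\<lambda>p. p $ 1 + t * p $ 2) P"
proof -
  let ?bad = "(\<lambda>(p, q). (q $ 1 - p $ 1) / (p $ 2 - q $ 2)) ` (P \<times> P)"
  have "finite ?bad" using assms by simp
  then obtain t where t: "t \<notin> ?bad" using ex_new_if_finite[OF infinite_UNIV_char_0] by blast
  have "inj_on (\<lambda>p. p $ 1 + t * p $ 2) P"
  proof (rule inj_onI)
    fix p q assume pq: "p \<in> P" "q \<in> P" "p $ 1 + t * p $ 2 = q $ 1 + t * q $ 2"
    then have eq: "t * (p $ 2 - q $ 2) = q $ 1 - p $ 1" by (simp add: algebra_simps)
    have "p $ 2 = q $ 2"
    proof (rule ccontr)
      assume "p $ 2 \<noteq> q $ 2"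
      then have "t = (q $ 1 - p $ 1) / (p $ 2 - q $ 2)" using eq by (simp add: field_simps)
      then show False using t pq by auto
    qed
    then show "p = q" using eq by (simp add: vec_eq_iff forall_2)
  qed
  then show thesis using that by blast
qed

text \<open>Cut by a vertical line into \<open>L\<close> and \<open>R\<close>, and by a line that bisects both. A third line misses one of the
  four quadrants: write its equation as \<open>\<alpha> \<xi> + \<beta> \<zeta> + \<gamma>\<close> in coordinates that vanish on the two cutting
  lines; on the quadrant where \<open>\<alpha> \<xi>\<close> and \<open>\<beta> \<zeta>\<close> have the sign of \<open>\<gamma>\<close> it does not change sign. In general
  position a line contains at most two of the points, which the slack of three points in each of \<open>L\<close> and \<open>R\<close> pays for.\<close>

lemma exists_four_part_split:
  assumes P: "finite P" and gp: "general_position P" and n: "4 * t + 6 \<le> card P"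
  shows "\<exists>Q :: bool \<times> bool \<Rightarrow> point set. (\<forall>i. Q i \<subseteq> P \<and> card (Q i) = t) \<and>
      (\<forall>i j. i \<noteq> j \<longrightarrow> separated (Q i) (Q j)) \<and> (\<forall>p q. \<exists>i. \<not> splits p q (Q i))"
proof -
  obtain v where inj: "inj_on (\<lambda>p. p $ 1 + v * p $ 2) P" using exists_injective_shear[OF P] .
  define X where "X p = p $ 1 + v * p $ 2" for p :: point
  define Y where "Y p = p $ 2" for p :: point
  have orient: "orient p q r = (X q - X p) * (Y r - Y p) - (X r - X p) * (Y q - Y p)" for p q r
    by (simp add: orient_def X_def Y_def algebra_simps)
  have "inj_on X P" using inj by (simp add: X_def[abs_def])
  then obtain L where L: "L \<subseteq> P" "card L = 2 * t + 3" "\<And>p q. p \<in> L \<Longrightarrow> q \<in> P - L \<Longrightarrow> X p < X q"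
    using exists_initial_subset[OF P, of X "2 * t + 3"] n by auto
  have "card (P - L) \<ge> 2 * t + 3"
    using L n P by (simp add: card_Diff_subset finite_subset)
  then obtain R where R: "R \<subseteq> P - L" "card R = 2 * t + 3"
    using obtain_subset_with_card_n by metis
  have fin: "finite L" "finite R" using L R P finite_subset by blast+
  have LR: "X p < X q" if "p \<in> L" "q \<in> R" for p q using L R that by auto
  have k: "1 \<le> t + 2" "t + 2 \<le> card L" "t + 2 \<le> card R" using L R by simp_all
  obtain m c where mc:
    "card {p \<in> L. Y p - m * X p < c} < t + 2" "t + 2 \<le> card {p \<in> L. Y p - m * X p \<le> c}"
    "card {p \<in> R. Y p - m * X p < c} < t + 2" "t + 2 \<le> card {p \<in> R. Y p - m * X p \<le> c}"
    by (rule exists_bisecting_line[where X = X and Y = Y and k = "t + 2", OF fin LR k])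
  define Z where "Z p = Y p - m * X p" for p
  have on_line: "card {p \<in> S. Z p = c} \<le> 2" if "S \<subseteq> P" for S
  proof (rule ccontr)
    assume "\<not> ?thesis"
    then have "3 \<le> card {p \<in> S. Z p = c}" by linarith
    from obtain_subset_with_card_n[OF this]
    obtain T where T: "T \<subseteq> {p \<in> S. Z p = c}" "card T = 3" by metis
    then obtain p q r where pqr: "T = {p, q, r}" "p \<noteq> q" "q \<noteq> r" "p \<noteq> r" by (auto simp: card_3_iff)
    then have Y: "Y p = c + m * X p" "Y q = c + m * X q" "Y r = c + m * X r"
      using T by (auto simp: Z_def)
    have "orient p q r = 0" unfolding orient Y by (simp add: algebra_simps)
    moreover have "p \<in> P" "q \<in> P" "r \<in> P" using T pqr that by auto
    ultimately show False using general_position_orient[OF gp] pqr by blast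
  qed
  have sides: "t \<le> card {p \<in> S. Z p < c} \<and> t \<le> card {p \<in> S. Z p > c}"
    if S: "S \<subseteq> P" "card S = 2 * t + 3" "card {p \<in> S. Z p < c} < t + 2" "t + 2 \<le> card {p \<in> S. Z p \<le> c}"
    for S
  proof -
    have "{p \<in> S. Z p \<le> c} = {p \<in> S. Z p < c} \<union> {p \<in> S. Z p = c}" by auto
    then have 1: "card {p \<in> S. Z p \<le> c} \<le> card {p \<in> S. Z p < c} + card {p \<in> S. Z p = c}"
      by (simp add: card_Un_le)
    have "{p \<in> S. Z p \<le> c} \<union> {p \<in> S. Z p > c} = S" by auto
    then have 2: "card S \<le> card {p \<in> S. Z p \<le> c} + card {p \<in> S. Z p > c}"
      using card_Un_le[of "{p \<in> S. Z p \<le> c}" "{p \<in> S. Z p > c}"] by simp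
    show ?thesis using 1 2 on_line[OF S(1)] S by linarith
  qed
  let ?side = "\<lambda>(l, u). {p \<in> (if l then L else R). if u then Z p > c else Z p < c}"
  have "t \<le> card (?side i)" for i
  proof -
    have "R \<subseteq> P" using R by blast
    note sidesLR = sides[OF L(1,2) mc(1,2)[folded Z_def]] sides[OF this R(2) mc(3,4)[folded Z_def]]
    obtain l u where "i = (l, u)" by force
    then show ?thesis using sidesLR by (cases l; cases u) simp_all
  qed
  then have "\<exists>T. T \<subseteq> ?side i \<and> card T = t" for i
    by (rule obtain_subset_with_card_n[of t "?side i"]) blast
  then have "\<forall>i. \<exists>T. T \<subseteq> ?side i \<and> card T = t" by (rule allI)
  from choice[OF this] obtain Q where "\<forall>i. Q i \<subseteq> ?side i \<and> card (Q i) = t" by (rule exE)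
  note Q' = this[THEN spec]
  have Q: "Q i \<subseteq> ?side i" "card (Q i) = t" for i
    by (rule conjunct1[OF Q']) (rule conjunct2[OF Q'])
  have QP: "Q i \<subseteq> P" for i using Q(1)[of i] L R by (auto split: prod.splits if_splits)
  have sepX: "separated L R"
    unfolding separated_def
    by (rule exI[of _ "vector [1, v]"]) (use LR in \<open>auto simp: inner_point X_def\<close>)
  have sepZ: "separated {p \<in> S. Z p < c} {p \<in> S. Z p > c}" for S
    unfolding separated_def
    by (rule exI[of _ "vector [- m, 1 - m * v]"])
      (fastforce simp: inner_point Z_def X_def Y_def algebra_simps)
  have sep: "separated (Q i) (Q j)" if "i \<noteq> j" for i j
  proof -
    obtain l u l' u' where ij: "i = (l, u)" "j = (l', u')" by force
    show ?thesis
    proof (cases "l = l'")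
      case True
      let ?S = "if l then L else R"
      from True have "u \<noteq> u'" using that ij by auto
      then show ?thesis
        using separated_mono[OF sepZ[of ?S], of "Q i" "Q j"]
          separated_sym[OF separated_mono[OF sepZ[of ?S], of "Q j" "Q i"]] Q(1)[of i] Q(1)[of j] True ij
        by (cases u; cases u') auto
    next
      case False
      have "Q (l, u) \<subseteq> (if l then L else R)" for l u using Q(1)[of "(l, u)"] by auto
      then have "Q i \<subseteq> (if l then L else R)" "Q j \<subseteq> (if l' then L else R)" using ij by auto
      then show ?thesis
        using separated_mono[OF sepX, of "Q i" "Q j"] separated_sym[OF separated_mono[OF sepX, of "Q j" "Q i"]] False
        by (cases l; cases l') auto
    qed
  qed
  define x0 where "x0 = Max (X ` L)"
  have "L \<noteq> {}" using L by auto
  then have "x0 \<in> X ` L" unfolding x0_def using fin by (intro Max_in) auto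
  then have x0: "X p \<le> x0" if "p \<in> L" for p
    using that fin by (simp add: x0_def)
  have x0': "x0 \<le> X p" if "p \<in> R" for p
    using LR that \<open>x0 \<in> X ` L\<close> by (auto simp: less_imp_le)
  have "\<exists>i. \<not> splits p q (Q i)" for p q
  proof -
    define \<beta> where "\<beta> = X q - X p"
    define \<alpha> where "\<alpha> = \<beta> * m - (Y q - Y p)"
    define \<gamma> where "\<gamma> = - \<alpha> * (X p - x0) - \<beta> * (Z p - c)"
    have eq: "orient p q r = \<alpha> * (X r - x0) + \<beta> * (Z r - c) + \<gamma>" for r
      by (simp add: \<gamma>_def orient \<alpha>_def \<beta>_def Z_def algebra_simps)
    show ?thesis
    proof (cases "\<gamma> \<ge> 0")
      case True
      have "\<not> splits p q (Q (\<alpha> \<le> 0, \<beta> \<ge> 0))"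
      proof -
        have "orient p q r \<ge> 0" if "r \<in> Q (\<alpha> \<le> 0, \<beta> \<ge> 0)" for r
        proof -
          have r: "r \<in> ?side (\<alpha> \<le> 0, \<beta> \<ge> 0)" using Q(1) that by blast
          have "\<alpha> * (X r - x0) \<ge> 0"
            using r x0[of r] x0'[of r] by (auto simp: zero_le_mult_iff split: if_splits)
          moreover have "\<beta> * (Z r - c) \<ge> 0"
            using r by (auto simp: zero_le_mult_iff split: if_splits)
          ultimately show ?thesis using eq[of r] True by linarith
        qed
        then show ?thesis unfolding splits_def by force
      qed
      then show ?thesis by blast
    next
      case False
      have "\<not> splits p q (Q (\<alpha> \<ge> 0, \<beta> \<le> 0))"
      proof -
        have "orient p q r \<le> 0" if "r \<in> Q (\<alpha> \<ge> 0, \<beta> \<le> 0)" for r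
        proof -
          have r: "r \<in> ?side (\<alpha> \<ge> 0, \<beta> \<le> 0)" using Q(1) that by blast
          have "\<alpha> * (X r - x0) \<le> 0"
            using r x0[of r] x0'[of r] by (auto simp: mult_le_0_iff split: if_splits)
          moreover have "\<beta> * (Z r - c) \<le> 0"
            using r by (auto simp: mult_le_0_iff split: if_splits)
          ultimately show ?thesis using eq[of r] False by linarith
        qed
        then show ?thesis unfolding splits_def by force
      qed
      then show ?thesis by blast
    qed
  qed
  then show ?thesis using Q QP sep by blast
qed

text \<open>Iterating the split \<open>m\<close> times gives \<open>4 ^ m\<close> parts of equal size. A line misses one of four parts at each
  stage and so splits at most the fraction \<open>(3 / 4) ^ m\<close> of them, while the number of parts stays
  independent of the number of points. The term \<open>s + 2\<close> absorbs the points lost in the iteration: for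
  \<open>f m = 4 ^ m * (s + 2) - 2\<close> one has \<open>4 * f m + 6 = f (Suc m)\<close>.\<close>

lemma exists_partition_few_split:
  assumes "finite P" "general_position P" "1 \<le> s" "4 ^ m * (s + 2) \<le> card P + 2"
  shows "\<exists>\<P>. card \<P> = 4 ^ m \<and> (\<forall>Q\<in>\<P>. Q \<subseteq> P \<and> card Q = s) \<and>
      (\<forall>Q\<in>\<P>. \<forall>Q'\<in>\<P>. Q \<noteq> Q' \<longrightarrow> separated Q Q') \<and>
      (\<forall>p q. card {Q \<in> \<P>. splits p q Q} \<le> 3 ^ m)"
  using assms(1,2,4)
proof (induction m arbitrary: P)
  case 0
  then obtain Q where "Q \<subseteq> P" "card Q = s" using obtain_subset_with_card_n[of s P] by auto
  moreover have "card {Q' \<in> {Q}. splits p q Q'} \<le> 1" for p q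
    using card_mono[of "{Q}" "{Q' \<in> {Q}. splits p q Q'}"] by auto
  ultimately show ?case by (intro exI[of _ "{Q}"]) auto
next
  case (Suc m)
  define t where "t = 4 ^ m * (s + 2) - 2"
  have "(1::nat) * 3 \<le> 4 ^ m * (s + 2)" using assms(3) by (intro mult_mono) auto
  then have t: "4 ^ m * (s + 2) = t + 2" by (simp add: t_def)
  have "4 * t + 6 \<le> card P" using Suc.prems(3) t by simp
  from exists_four_part_split[OF Suc.prems(1,2) this]
  obtain Q :: "bool \<times> bool \<Rightarrow> point set" where
    Q': "\<forall>i. Q i \<subseteq> P \<and> card (Q i) = t" "\<forall>i j. i \<noteq> j \<longrightarrow> separated (Q i) (Q j)"
      "\<forall>p q. \<exists>i. \<not> splits p q (Q i)"
    by (elim exE conjE)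
  have Q: "Q i \<subseteq> P" "card (Q i) = t" "i \<noteq> j \<Longrightarrow> separated (Q i) (Q j)"
      "\<exists>i. \<not> splits p q (Q i)" for i j p q
    using Q'(1)[THEN spec, of i] Q'(2)[THEN spec, THEN spec, of i j] Q'(3)[THEN spec, THEN spec, of p q]
    by argo+
  have "\<forall>i. \<exists>\<P>. card \<P> = 4 ^ m \<and> (\<forall>S\<in>\<P>. S \<subseteq> Q i \<and> card S = s) \<and>
      (\<forall>S\<in>\<P>. \<forall>S'\<in>\<P>. S \<noteq> S' \<longrightarrow> separated S S') \<and>
      (\<forall>p q. card {S \<in> \<P>. splits p q S} \<le> 3 ^ m)"
  proof
    fix i
    have "finite (Q i)" using Q(1) Suc.prems(1) finite_subset by blast
    moreover have "general_position (Q i)"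
      using Suc.prems(2) Q(1)[of i] unfolding general_position_def by blast
    ultimately show "\<exists>\<P>. card \<P> = 4 ^ m \<and> (\<forall>S\<in>\<P>. S \<subseteq> Q i \<and> card S = s) \<and>
      (\<forall>S\<in>\<P>. \<forall>S'\<in>\<P>. S \<noteq> S' \<longrightarrow> separated S S') \<and>
      (\<forall>p q. card {S \<in> \<P>. splits p q S} \<le> 3 ^ m)"
      using t by (intro Suc.IH) (simp_all only: Q(2) le_refl)
  qed
  from choice[OF this] obtain \<P> where
    \<P>': "\<forall>i. card (\<P> i) = 4 ^ m \<and> (\<forall>S\<in>\<P> i. S \<subseteq> Q i \<and> card S = s) \<and>
      (\<forall>S\<in>\<P> i. \<forall>S'\<in>\<P> i. S \<noteq> S' \<longrightarrow> separated S S') \<and>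
      (\<forall>p q. card {S \<in> \<P> i. splits p q S} \<le> 3 ^ m)"
    by (rule exE)
  have \<P>: "card (\<P> i) = 4 ^ m" "S \<in> \<P> i \<Longrightarrow> S \<subseteq> Q i" "S \<in> \<P> i \<Longrightarrow> card S = s"
      "S \<in> \<P> i \<Longrightarrow> S' \<in> \<P> i \<Longrightarrow> S \<noteq> S' \<Longrightarrow> separated S S'"
      "card {S \<in> \<P> i. splits p q S} \<le> 3 ^ m" for i S S' p q
    using \<P>'[THEN spec, of i] by simp_all
  have fin: "finite (\<P> i)" for i using \<P>(1)[of i] by (metis card.infinite power_not_zero zero_neq_numeral)
  have "\<P> i \<inter> \<P> j = {}" if "i \<noteq> j" for i j
  proof (rule ccontr)
    assume "\<P> i \<inter> \<P> j \<noteq> {}"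
    then obtain S where S: "S \<in> \<P> i" "S \<in> \<P> j" by blast
    then have "S \<subseteq> Q i \<inter> Q j" using \<P>(2) by blast
    then have "S = {}" using separated_disjoint[OF Q(3)[OF that]] by blast
    then show False using \<P>(3)[OF S(1)] assms(3) by simp
  qed
  then have "card (\<Union>i. \<P> i) = (\<Sum>i\<in>UNIV. card (\<P> i))"
    by (intro card_UN_disjoint) (auto simp: fin)
  also have "\<dots> = 4 ^ Suc m" by (simp add: \<P>(1))
  finally have card: "card (\<Union>i. \<P> i) = 4 ^ Suc m" .
  have sep: "separated S S'" if S: "S \<in> (\<Union>i. \<P> i)" "S' \<in> (\<Union>i. \<P> i)" "S \<noteq> S'" for S S'
  proof -
    obtain i where i: "S \<in> \<P> i" using S(1) by (rule UN_E)
    obtain j where j: "S' \<in> \<P> j" using S(2) by (rule UN_E)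
    show ?thesis
    proof (cases "i = j")
      case True
      then show ?thesis using \<P>(4)[OF i _ S(3)] j by simp
    next
      case False
      then show ?thesis by (rule separated_mono[OF Q(3) \<P>(2)[OF i] \<P>(2)[OF j]])
    qed
  qed
  have few: "card {S \<in> (\<Union>i. \<P> i). splits p q S} \<le> 3 ^ Suc m" for p q
  proof -
    obtain i0 where i0: "\<not> splits p q (Q i0)" using Q(4) by blast
    have "{S \<in> (\<Union>i. \<P> i). splits p q S} \<subseteq> (\<Union>i\<in>UNIV - {i0}. {S \<in> \<P> i. splits p q S})"
    proof
      fix S assume "S \<in> {S \<in> (\<Union>i. \<P> i). splits p q S}"
      then obtain i where i: "S \<in> \<P> i" "splits p q S" by blast
      then have "i \<noteq> i0" using i0 splits_mono[OF i(2) \<P>(2)[OF i(1)]] by blast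
      then show "S \<in> (\<Union>i\<in>UNIV - {i0}. {S \<in> \<P> i. splits p q S})" using i by blast
    qed
    then have "card {S \<in> (\<Union>i. \<P> i). splits p q S} \<le> card (\<Union>i\<in>UNIV - {i0}. {S \<in> \<P> i. splits p q S})"
      by (intro card_mono) (auto simp: fin)
    also have "\<dots> \<le> (\<Sum>i\<in>UNIV - {i0}. card {S \<in> \<P> i. splits p q S})"
      by (rule card_UN_le) simp
    also have "\<dots> \<le> (\<Sum>i\<in>UNIV - {i0}. 3 ^ m)" by (intro sum_mono \<P>(5))
    also have "\<dots> = 3 ^ Suc m" by (simp add: card_Diff_singleton)
    finally show ?thesis .
  qed
  have parts: "S \<subseteq> P" "card S = s" if S: "S \<in> (\<Union>i. \<P> i)" for S
  proof -
    obtain i where i: "S \<in> \<P> i" using S by (rule UN_E)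
    show "S \<subseteq> P" using \<P>(2)[OF i] Q(1)[of i] by (rule subset_trans)
    show "card S = s" by (rule \<P>(3)[OF i])
  qed
  show ?case
  proof (rule exI[of _ "\<Union>i. \<P> i"], intro conjI)
    show "card (\<Union>i. \<P> i) = 4 ^ Suc m" by (rule card)
    show "\<forall>S\<in>(\<Union>i. \<P> i). S \<subseteq> P \<and> card S = s"
      using parts by (intro ballI conjI)
    show "\<forall>S\<in>(\<Union>i. \<P> i). \<forall>S'\<in>(\<Union>i. \<P> i). S \<noteq> S' \<longrightarrow> separated S S'"
      using sep by (intro ballI impI)
    show "\<forall>p q. card {S \<in> (\<Union>i. \<P> i). splits p q S} \<le> 3 ^ Suc m"
      using few by (intro allI)
  qed
qed

section \<open>Dense geometric graphs\<close>

text \<open>Divide \<open>V\<close> into \<open>K = 4 ^ m\<close> parts of size \<open>s\<close> and look at all ordered pairs of distinct parts. A line splits few parts, so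
  summed over these pairs the loss in the bound for separated sets is at most \<open>4 (3 / 4) ^ m n\<^sup>2\<close>; few edges meet the \<open>3 K\<close> points left over, and few
  lie inside a part. If no pair had a crossing family of the required size, then the
  total number of edges would be at most \<open>\<delta> n\<^sup>2 (1 / 2 + 4 / 24 + 1 / 4 + 1 / 24) < \<delta> n\<^sup>2\<close>.\<close>

lemma exists_crossing_family_if_many_edges:
  fixes V :: "point set" and \<delta> :: real
  assumes V: "finite V" "general_position V" and E: "E \<subseteq> segments_of V"
    and dense: "\<delta> * (card V)\<^sup>2 \<le> card E" and \<delta>: "0 < \<delta>"
    and m: "(3 / 4) ^ m \<le> \<delta> / 24" and big: "24 * 4 ^ m \<le> \<delta> * card V" and small: "\<delta> \<le> 1"
  shows "\<exists>F\<subseteq>E. pairwise segments_cross F \<and> \<delta> * card V / (4 * 4 ^ m) \<le> card F"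
proof (rule ccontr)
  assume none: "\<not> ?thesis"
  define n where "n = card V"
  define K where "K = (4::nat) ^ m"
  define s where "s = n div K - 2"
  define T where "T = \<delta> * n / (4 * K)"
  have K: "0 < K" by (simp add: K_def)
  have less: "real (card F) < T" if "F \<subseteq> E" "pairwise segments_cross F" for F
    using none that by (auto simp: T_def K_def n_def not_le)
  have big': "24 * real K \<le> \<delta> * n" using big by (simp add: K_def n_def)
  also have "\<dots> \<le> 1 * real n" using small by (intro mult_right_mono) auto
  finally have nK: "24 * K \<le> n" by linarith
  then have "24 * K div K \<le> n div K" by (rule div_le_mono)
  then have s2: "n div K = s + 2" "1 \<le> s" using K by (auto simp: s_def)
  have Ks: "K * (s + 2) \<le> n" "n < K * (s + 3)"
  proof -
    have nd: "n = K * (s + 2) + n mod K" using s2 by (metis mult_div_mod_eq)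
    then show "K * (s + 2) \<le> n" by linarith
    have "n mod K < K" using K by simp
    then show "n < K * (s + 3)" using nd by (simp add: algebra_simps)
  qed
  obtain \<P> where \<P>: "card \<P> = K" "\<And>Q. Q \<in> \<P> \<Longrightarrow> Q \<subseteq> V" "\<And>Q. Q \<in> \<P> \<Longrightarrow> card Q = s"
      "\<And>Q Q'. Q \<in> \<P> \<Longrightarrow> Q' \<in> \<P> \<Longrightarrow> Q \<noteq> Q' \<Longrightarrow> separated Q Q'"
      "\<And>p q. card {Q \<in> \<P>. splits p q Q} \<le> 3 ^ m"
    using exists_partition_few_split[OF V s2(2), of m] Ks(1) unfolding K_def n_def by auto
  have finP: "finite \<P>" using \<P>(1) K card.infinite by fastforce
  have finQ: "finite Q" if "Q \<in> \<P>" for Q using \<P>(2)[OF that] V finite_subset by blast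
  define M where "M = (\<lambda>(Q, Q'). {(p, q) \<in> Q \<times> Q'. {p, q} \<in> E})"
  define I where "I Q Q' = card {(a, a') \<in> Q \<times> Q. splits a a' Q'}" for Q Q'
  define D where "D = {(Q, Q') \<in> \<P> \<times> \<P>. Q \<noteq> Q'}"
  have finD: "finite D" using finP by (auto simp: D_def intro: finite_subset[of _ "\<P> \<times> \<P>"])
  have cardD: "card D \<le> K\<^sup>2"
  proof -
    have "card D \<le> card (\<P> \<times> \<P>)" using finP by (intro card_mono) (auto simp: D_def)
    then show ?thesis using \<P>(1) by (simp add: card_cartesian_product power2_eq_square)
  qed
  have one: "real (card (M (Q, Q'))) \<le> T * (2 * s) + 2 * real (I Q Q' + I Q' Q)"
    if "(Q, Q') \<in> D" for Q Q'
  proof -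
    have mem: "Q \<in> \<P>" "Q' \<in> \<P>" "Q \<noteq> Q'" using that by (auto simp: D_def)
    have disj: "Q \<inter> Q' = {}" using separated_disjoint[OF \<P>(4)[OF mem]] .
    obtain F where F: "F \<subseteq> M (Q, Q')"
      "\<forall>e\<in>F. \<forall>f\<in>F. e \<noteq> f \<longrightarrow> segments_cross {fst e, snd e} {fst f, snd f}"
      "card (M (Q, Q')) \<le> card F * (card Q + card Q') + 2 * (I Q Q' + I Q' Q)"
      using exists_crossing_between_separated[OF V(2) \<P>(2)[OF mem(1)] \<P>(2)[OF mem(2)]
          finQ[OF mem(1)] finQ[OF mem(2)] \<P>(4)[OF mem], of "M (Q, Q')"]
      unfolding I_def by (auto simp: M_def)
    let ?seg = "\<lambda>e. {fst e, snd e} :: point set"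
    have "inj_on ?seg F"
    proof (rule inj_onI)
      fix e f assume ef: "e \<in> F" "f \<in> F" "?seg e = ?seg f"
      then have "fst e \<in> Q" "snd e \<in> Q'" "fst f \<in> Q" "snd f \<in> Q'" using F(1) by (auto simp: M_def)
      then show "e = f" using ef(3) disj by (auto simp: doubleton_eq_iff prod_eq_iff)
    qed
    then have "card (?seg ` F) = card F" by (rule card_image)
    moreover have "?seg ` F \<subseteq> E" using F(1) by (auto simp: M_def)
    moreover have "pairwise segments_cross (?seg ` F)" using F(2) by (auto simp: pairwise_def)
    ultimately have "real (card F) < T" using less[of "?seg ` F"] by simp
    then have "real (card F) * (2 * s) \<le> T * (2 * s)" by (intro mult_right_mono) auto
    moreover have "real (card (M (Q, Q'))) \<le> real (card F) * (2 * s) + 2 * real (I Q Q' + I Q' Q)"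
    proof -
      have "real (card (M (Q, Q'))) \<le> real (card F * (card Q + card Q') + 2 * (I Q Q' + I Q' Q))"
        using F(3) by (rule of_nat_mono)
      also have "card Q + card Q' = 2 * s" using \<P>(3) mem by simp
      finally show ?thesis by simp
    qed
    ultimately show ?thesis by linarith
  qed
  \<comment> \<open>Double counting: a pair of points inside a part splits at most \<open>3 ^ m\<close> of the parts.\<close>
  have sumI: "(\<Sum>Q\<in>\<P>. \<Sum>Q'\<in>\<P>. I Q Q') \<le> K * (s * s * 3 ^ m)"
  proof -
    have "(\<Sum>Q'\<in>\<P>. I Q Q') \<le> s * s * 3 ^ m" if Q: "Q \<in> \<P>" for Q
    proof -
      have "(\<Sum>Q'\<in>\<P>. I Q Q') = (\<Sum>Q'\<in>\<P>. \<Sum>e\<in>Q \<times> Q. if splits (fst e) (snd e) Q' then 1 else 0)"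
      proof (rule sum.cong[OF refl])
        fix Q' assume "Q' \<in> \<P>"
        have "{(a, a') \<in> Q \<times> Q. splits a a' Q'} = {e \<in> Q \<times> Q. splits (fst e) (snd e) Q'}" by auto
        then show "I Q Q' = (\<Sum>e\<in>Q \<times> Q. if splits (fst e) (snd e) Q' then 1 else 0)"
          unfolding I_def using finQ[OF Q] by (simp add: sum.If_cases Int_def)
      qed
      also have "\<dots> = (\<Sum>e\<in>Q \<times> Q. \<Sum>Q'\<in>\<P>. if splits (fst e) (snd e) Q' then 1 else 0)"
        by (rule sum.swap)
      also have "\<dots> = (\<Sum>e\<in>Q \<times> Q. card {Q' \<in> \<P>. splits (fst e) (snd e) Q'})"
        using finP by (simp add: sum.If_cases Int_def)
      also have "\<dots> \<le> (\<Sum>e\<in>Q \<times> Q. 3 ^ m)" by (intro sum_mono \<P>(5))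
      also have "\<dots> = s * s * 3 ^ m" using \<P>(3)[OF Q] by (simp add: card_cartesian_product)
      finally show ?thesis .
    qed
    then have "(\<Sum>Q\<in>\<P>. \<Sum>Q'\<in>\<P>. I Q Q') \<le> (\<Sum>Q\<in>\<P>. s * s * 3 ^ m)" by (intro sum_mono)
    then show ?thesis using \<P>(1) by simp
  qed
  have sumID: "(\<Sum>(Q, Q')\<in>D. I Q Q' + I Q' Q) \<le> 2 * (K * (s * s * 3 ^ m))"
  proof -
    have "(\<Sum>(Q, Q')\<in>D. I Q Q' + I Q' Q) \<le> (\<Sum>(Q, Q')\<in>\<P> \<times> \<P>. I Q Q' + I Q' Q)"
      using finP by (intro sum_mono2) (auto simp: D_def)
    also have "\<dots> = (\<Sum>Q\<in>\<P>. \<Sum>Q'\<in>\<P>. I Q Q' + I Q' Q)"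
      by (simp add: sum.cartesian_product)
    also have "\<dots> = (\<Sum>Q\<in>\<P>. \<Sum>Q'\<in>\<P>. I Q Q') + (\<Sum>Q\<in>\<P>. \<Sum>Q'\<in>\<P>. I Q' Q)"
      by (simp add: sum.distrib)
    also have "(\<Sum>Q\<in>\<P>. \<Sum>Q'\<in>\<P>. I Q' Q) = (\<Sum>Q\<in>\<P>. \<Sum>Q'\<in>\<P>. I Q Q')"
      by (rule sum.swap)
    finally show ?thesis using sumI by linarith
  qed
  have sumM: "(\<Sum>x\<in>D. real (card (M x))) \<le> (real K)\<^sup>2 * (T * (2 * s)) + 4 * (K * (s * s * 3 ^ m))"
  proof -
    have "(\<Sum>x\<in>D. real (card (M x))) \<le> (\<Sum>x\<in>D. T * (2 * s) + 2 * real (case x of (Q, Q') \<Rightarrow> I Q Q' + I Q' Q))"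
      using one by (intro sum_mono) (auto split: prod.splits)
    also have "\<dots> = real (card D) * (T * (2 * s)) + 2 * real (\<Sum>(Q, Q')\<in>D. I Q Q' + I Q' Q)"
      by (simp add: sum.distrib sum_distrib_left)
    also have "\<dots> \<le> real (K\<^sup>2) * (T * (2 * s)) + 2 * real (2 * (K * (s * s * 3 ^ m)))"
      using cardD sumID \<delta> by (intro add_mono mult_right_mono mult_left_mono of_nat_mono) (auto simp: T_def)
    finally show ?thesis by simp
  qed
  define U where "U = \<Union>\<P>"
  have U: "U \<subseteq> V" "card U = K * s"
  proof -
    show "U \<subseteq> V" using \<P>(2) by (auto simp: U_def)
    have "card U = (\<Sum>Q\<in>\<P>. card Q)" unfolding U_def
      by (intro card_Union_disjoint) (use \<P>(4) separated_disjoint finQ in \<open>auto simp: disjoint_def\<close>)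
    then show "card U = K * s" using \<P>(1,3) by simp
  qed
  have rest: "card (V - U) \<le> 3 * K"
  proof -
    have "card (V - U) = n - K * s" using U V by (simp add: card_Diff_subset finite_subset n_def)
    then show ?thesis using Ks by (simp add: algebra_simps)
  qed
  let ?R = "(V - U) \<times> V \<union> V \<times> (V - U)" and ?S = "\<Union>Q\<in>\<P>. Q \<times> Q"
  have sub: "E \<subseteq> (\<lambda>(p, q). {p, q}) ` ((\<Union>x\<in>D. M x) \<union> ?R \<union> ?S)"
  proof
    fix e assume e: "e \<in> E"
    then have "e \<subseteq> V" "card e = 2" using E by (auto simp: segments_of_def)
    then obtain p q where pq: "e = {p, q}" "p \<in> V" "q \<in> V" by (auto simp: card_2_iff)
    have "(p, q) \<in> (\<Union>x\<in>D. M x) \<union> ?R \<union> ?S"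
    proof (cases "p \<in> U \<and> q \<in> U")
      case True
      then obtain Q Q' where Q: "Q \<in> \<P>" "p \<in> Q" "Q' \<in> \<P>" "q \<in> Q'" by (auto simp: U_def)
      show ?thesis
      proof (cases "Q = Q'")
        case True
        then show ?thesis using Q by blast
      next
        case False
        then have "(Q, Q') \<in> D" "(p, q) \<in> M (Q, Q')" using Q e pq by (auto simp: D_def M_def)
        then show ?thesis by blast
      qed
    qed (use pq in blast)
    then show "e \<in> (\<lambda>(p, q). {p, q}) ` ((\<Union>x\<in>D. M x) \<union> ?R \<union> ?S)"
      using pq by (intro image_eqI[of _ _ "(p, q)"]) auto
  qed
  have finM: "finite (M x)" if "x \<in> D" for x
    using that finQ by (auto simp: D_def M_def intro: finite_subset[of _ "fst x \<times> snd x"])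
  have "card E \<le> card ((\<Union>x\<in>D. M x) \<union> ?R \<union> ?S)"
  proof -
    have fin: "finite ((\<Union>x\<in>D. M x) \<union> ?R \<union> ?S)" using finD finM V finP finQ by auto
    show ?thesis by (rule surj_card_le[OF fin sub])
  qed
  also have "\<dots> \<le> card (\<Union>x\<in>D. M x) + card ?R + card ?S"
    by (meson add_le_mono1 card_Un_le le_trans)
  also have "\<dots> \<le> (\<Sum>x\<in>D. card (M x)) + 2 * (3 * K * n) + K * (s * s)"
  proof (intro add_mono)
    show "card (\<Union>x\<in>D. M x) \<le> (\<Sum>x\<in>D. card (M x))" by (rule card_UN_le[OF finD])
    have "card ?R \<le> card (V - U) * n + n * card (V - U)"
      using card_Un_le[of "(V - U) \<times> V" "V \<times> (V - U)"] by (simp add: card_cartesian_product n_def)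
    also have "\<dots> \<le> 3 * K * n + n * (3 * K)" using rest by (intro add_mono mult_le_mono) auto
    finally show "card ?R \<le> 2 * (3 * K * n)" by simp
    have "card ?S \<le> (\<Sum>Q\<in>\<P>. card (Q \<times> Q))" by (rule card_UN_le[OF finP])
    also have "\<dots> = K * (s * s)" using \<P>(1,3) by (simp add: card_cartesian_product)
    finally show "card ?S \<le> K * (s * s)" .
  qed
  finally have "real (card E) \<le> real ((\<Sum>x\<in>D. card (M x)) + 2 * (3 * K * n) + K * (s * s))"
    by (rule of_nat_mono)
  also have "\<dots> \<le> (real K)\<^sup>2 * (T * (2 * s)) + 4 * (K * (s * s * 3 ^ m)) + 6 * K * n + K * (s * s)"
    using sumM by simp
  finally have total: "\<delta> * (real n)\<^sup>2 \<le>
      (real K)\<^sup>2 * (T * (2 * s)) + 4 * (K * (s * s * 3 ^ m)) + 6 * K * n + K * (s * s)"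
    using dense by (simp add: n_def)
  have Ksn: "real K * s \<le> n"
  proof -
    have "K * s \<le> n" using Ks(1) by (simp add: algebra_simps)
    then show ?thesis by (metis of_nat_le_iff of_nat_mult)
  qed
  have Kpow: "real K = 4 ^ m" by (simp add: K_def)
  have sq: "(real K * s)\<^sup>2 \<le> (real n)\<^sup>2" using Ksn by (intro power_mono) auto
  have t1: "(real K)\<^sup>2 * (T * (2 * s)) \<le> \<delta> * (real n)\<^sup>2 / 2"
  proof -
    have "(real K)\<^sup>2 * (T * (2 * s)) = \<delta> * n * (real K * s) / 2"
      using K by (simp add: T_def power2_eq_square)
    also have "\<dots> \<le> \<delta> * n * real n / 2"
      using Ksn \<delta> by (intro divide_right_mono mult_left_mono) auto
    finally show ?thesis by (simp add: power2_eq_square mult.assoc)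
  qed
  have t2: "real (K * (s * s * 3 ^ m)) \<le> \<delta> / 24 * (real n)\<^sup>2"
  proof -
    have "real (K * (s * s * 3 ^ m)) = (real K * s)\<^sup>2 * (3 / 4) ^ m"
      by (simp add: power2_eq_square Kpow power_divide)
    also have "\<dots> \<le> (real n)\<^sup>2 * (\<delta> / 24)" using sq m by (intro mult_mono) auto
    finally show ?thesis by (simp add: mult.commute)
  qed
  have t3: "real (K * (s * s)) \<le> \<delta> / 24 * (real n)\<^sup>2"
  proof -
    have "(1::nat) \<le> 3 ^ m" by simp
    then have "K * (s * s) * 1 \<le> K * (s * s) * 3 ^ m" by (intro mult_le_mono2)
    then have "real (K * (s * s)) \<le> real (K * (s * s * 3 ^ m))"
      by (intro of_nat_mono) (simp add: mult.assoc)
    then show ?thesis using t2 by linarith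
  qed
  have t4: "6 * real K * n \<le> \<delta> * (real n)\<^sup>2 / 4"
  proof -
    have "24 * real K * n \<le> \<delta> * n * n" using big' by (intro mult_right_mono) auto
    then show ?thesis by (simp add: power2_eq_square mult.assoc)
  qed
  have "0 < \<delta> * (real n)\<^sup>2" using \<delta> nK K by simp
  then show False using total t1 t2 t3 t4 by simp
qed

text \<open>Choose \<open>m\<close> least with \<open>(3 / 4) ^ m \<le> \<delta> / 24\<close>. As \<open>(4 / 3) ^ 5 > 4\<close>, the number \<open>4 ^ m\<close> of parts is then at
  most \<open>(32 / \<delta>) ^ 5\<close>, which accounts for the exponent. When there are too few points for so many parts,
  the bound is at most one and a single edge will do.\<close>

theorem exists_crossing_family_dense:
  fixes V :: "point set" and \<delta> :: real
  assumes V: "finite V" "general_position V" and E: "E \<subseteq> segments_of V" and ne: "V \<noteq> {}"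
    and dense: "\<delta> * (card V)\<^sup>2 \<le> card E" and \<delta>: "0 < \<delta>" "\<delta> \<le> 1"
  shows "\<exists>F\<subseteq>E. pairwise segments_cross F \<and> \<delta> ^ 6 * card V / 2 ^ 30 \<le> card F"
proof -
  define m where "m = (LEAST m. (3 / 4 :: real) ^ m \<le> \<delta> / 24)"
  have ex: "\<exists>m. (3 / 4 :: real) ^ m \<le> \<delta> / 24"
    using real_arch_pow_inv[of "\<delta> / 24" "3 / 4"] \<delta> by (auto intro: less_imp_le)
  then have m: "(3 / 4 :: real) ^ m \<le> \<delta> / 24" unfolding m_def by (rule LeastI_ex)
  have "m \<noteq> 0" using m \<delta> by (cases m) auto
  then obtain k where k: "m = Suc k" by (cases m) auto
  have "\<delta> / 24 < (3 / 4 :: real) ^ k" using not_less_Least[of k] k unfolding m_def[symmetric]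
    by (metis lessI linorder_not_le m_def)
  then have "(4 / 3 :: real) ^ k * (\<delta> / 24) < (4 / 3) ^ k * (3 / 4) ^ k" by (intro mult_strict_left_mono) auto
  also have "\<dots> = 1" by (simp flip: power_mult_distrib)
  finally have "(4 / 3 :: real) ^ m < 32 / \<delta>" using \<delta> by (simp add: k field_simps)
  then have "((4 / 3 :: real) ^ m) ^ 5 \<le> (32 / \<delta>) ^ 5" by (intro power_mono) auto
  moreover have "(4 :: real) ^ m \<le> ((4 / 3) ^ 5) ^ m"
    by (intro power_mono) (auto simp: power_divide)
  moreover have "((4 / 3 :: real) ^ 5) ^ m = ((4 / 3) ^ m) ^ 5"
    by (simp only: power_mult[symmetric] mult.commute)
  ultimately have "(4 :: real) ^ m \<le> 32 ^ 5 / \<delta> ^ 5" by (simp only: power_divide)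
  then have K: "(4 :: real) ^ m * \<delta> ^ 5 \<le> 32 ^ 5" using \<delta> by (simp only: pos_le_divide_eq zero_less_power)
  have bound: "\<delta> ^ 6 * card V / 2 ^ 30 \<le> \<delta> * card V / (24 * 4 ^ m)"
  proof -
    have "24 * ((4::real) ^ m * \<delta> ^ 5) \<le> 2 ^ 30" using K by (simp add: mult.commute)
    then have "\<delta> * card V * (24 * ((4::real) ^ m * \<delta> ^ 5)) \<le> \<delta> * card V * 2 ^ 30"
      using \<delta> by (intro mult_left_mono) auto
    then show ?thesis by (simp add: field_simps power_numeral_reduce)
  qed
  show ?thesis
  proof (cases "24 * 4 ^ m \<le> \<delta> * card V")
    case True
    obtain F where F: "F \<subseteq> E" "pairwise segments_cross F" "\<delta> * card V / (4 * 4 ^ m) \<le> card F"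
      using exists_crossing_family_if_many_edges[OF V E dense \<delta>(1) m True \<delta>(2)] by blast
    have "\<delta> * card V / (24 * 4 ^ m) \<le> \<delta> * card V / (4 * 4 ^ m)"
      using \<delta> by (intro divide_left_mono) auto
    then show ?thesis using F bound by (intro exI[of _ F]) auto
  next
    case False
    have "0 < real (card E)"
      using dense \<delta> ne V by (smt (verit) card_gt_0_iff mult_pos_pos of_nat_0_less_iff zero_less_power)
    then obtain e where e: "e \<in> E" by fastforce
    have "\<delta> * card V / (24 * 4 ^ m) \<le> 1" using False by (simp add: divide_le_eq)
    with bound have "\<delta> ^ 6 * card V / 2 ^ 30 \<le> 1" by (rule order_trans)
    then show ?thesis using e by (intro exI[of _ "{e}"]) auto
  qed
qed

section \<open>Many pairwise crossing segments\<close>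

theorem theorem1p1:
  "(\<exists>C::real. C > 0 \<and>
      (\<forall>(n::nat) (V::point set).
         n \<ge> 2 \<and> finite V \<and> card V = n \<and> general_position V \<longrightarrow>
         (\<exists>F. F \<subseteq> segments_of V \<and> pairwise segments_cross F \<and>
              real (card F) \<ge> real n / 2 powr (C * sqrt (log 2 (real n))))))
   \<and>
   (\<exists>c::real.
      (\<forall>(n::nat) (\<epsilon>::real) (V::point set) (E::point set set).
         n \<ge> 2 \<and> \<epsilon> > log 2 (real n) powr (- (2 / 3)) \<and>
         geometric_graph V E \<and> card V = n \<and>
         real (card E) \<ge> real n powr (2 - \<epsilon>) \<longrightarrow>
         (\<exists>F. F \<subseteq> E \<and> pairwise segments_cross F \<and>
              real (card F) \<ge> real n powr (1 - c * sqrt \<epsilon>))))"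
proof (rule conjI[OF exI[of _ 42] exI[of _ 36]]; intro conjI allI impI)
  show "(42 :: real) > 0" by simp
next
  fix n :: nat and V :: "point set"
  assume "n \<ge> 2 \<and> finite V \<and> card V = n \<and> general_position V"
  then have n: "n \<ge> 2" and V: "finite V" "general_position V" "card V = n" by auto
  have "card (segments_of V) = n choose 2"
    using n_subsets[OF V(1), of 2] V(3) by (simp add: segments_of_def)
  moreover have "even (n * (n - 1))" by (cases n) auto
  ultimately have "2 * card (segments_of V) = n * (n - 1)"
    by (simp only: choose_two dvd_mult_div_cancel)
  then have "2 * real (card (segments_of V)) = real n * real (n - 1)"
    by (metis of_nat_mult of_nat_numeral)
  then have "real n * (real n - 1) = 2 * real (card (segments_of V))"
    using n by (simp add: of_nat_diff)
  moreover have "real n * real n \<le> real n * (2 * (real n - 1))"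
    using n by (intro mult_left_mono) auto
  moreover have "real n * (2 * (real n - 1)) = 2 * (real n * (real n - 1))" by simp
  ultimately have "real n * real n \<le> 4 * real (card (segments_of V))" by linarith
  then have "1 / 4 * (card V)\<^sup>2 \<le> card (segments_of V)"
    using V by (simp add: power2_eq_square)
  moreover have "V \<noteq> {}" using n V by auto
  ultimately obtain F where F: "F \<subseteq> segments_of V" "pairwise segments_cross F"
      "(1 / 4) ^ 6 * card V / 2 ^ 30 \<le> card F"
    using exists_crossing_family_dense[OF V(1,2) order_refl, of "1 / 4"] by auto
  have "real n / 2 powr (42 * sqrt (log 2 (real n))) \<le> real n / 2 ^ 42"
  proof (intro divide_left_mono)
    \<comment> \<open>The loss is a constant factor, and \<open>2 powr (42 * sqrt (log 2 n))\<close> is at least \<open>2 ^ 42\<close>.\<close>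
    have "1 \<le> log 2 (real n)" using n by (simp add: le_log_iff)
    then have "42 \<le> 42 * sqrt (log 2 (real n))" by simp
    then have "2 powr 42 \<le> 2 powr (42 * sqrt (log 2 (real n)))" by (intro powr_mono) auto
    then show "2 ^ 42 \<le> 2 powr (42 * sqrt (log 2 (real n)))" by (simp flip: powr_realpow)
  qed auto
  also have "\<dots> = (1 / 4) ^ 6 * card V / 2 ^ 30" using V by (simp add: power_divide)
  finally have "real n / 2 powr (42 * sqrt (log 2 (real n))) \<le> real (card F)" using F(3) by linarith
  then show "\<exists>F. F \<subseteq> segments_of V \<and> pairwise segments_cross F \<and>
      real (card F) \<ge> real n / 2 powr (42 * sqrt (log 2 (real n)))" using F(1,2) by blast
next
  fix n :: nat and \<epsilon> :: real and V :: "point set" and E :: "point set set"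
  assume "n \<ge> 2 \<and> \<epsilon> > log 2 (real n) powr (- (2 / 3)) \<and> geometric_graph V E \<and> card V = n \<and>
    real (card E) \<ge> real n powr (2 - \<epsilon>)"
  then have n: "n \<ge> 2" and \<epsilon>: "\<epsilon> > log 2 (real n) powr (- (2 / 3))"
    and V: "finite V" "general_position V" "E \<subseteq> segments_of V" "card V = n"
    and E: "real (card E) \<ge> real n powr (2 - \<epsilon>)" by (auto simp: geometric_graph_def)
  define L where "L = log 2 (real n)"
  have L: "1 \<le> L" using n by (simp add: L_def le_log_iff)
  have "0 < L powr (- (2 / 3))" using L by simp
  then have \<epsilon>0: "0 < \<epsilon>" using \<epsilon> unfolding L_def by linarith
  have nL: "real n = 2 powr L" using n by (simp add: L_def)
  show "\<exists>F. F \<subseteq> E \<and> pairwise segments_cross F \<and> real (card F) \<ge> real n powr (1 - 36 * sqrt \<epsilon>)"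
  proof (cases "\<epsilon> \<le> 1")
    case True
    let ?\<delta> = "real n powr - \<epsilon>"
    have "real n powr (2 - \<epsilon>) = ?\<delta> * real n powr 2"
      using powr_add[of "real n" "- \<epsilon>" 2] by (simp only: minus_add_cancel uminus_add_conv_diff)
    also have "real n powr 2 = (real n)\<^sup>2" using n by (simp add: powr_numeral)
    finally have "?\<delta> * (card V)\<^sup>2 \<le> card E" using E V by simp
    moreover have "?\<delta> \<le> 1" using n \<epsilon>0 by (simp add: powr_minus_divide ge_one_powr_ge_zero)
    moreover have "V \<noteq> {}" "0 < ?\<delta>" using n V by auto
    ultimately obtain F where F: "F \<subseteq> E" "pairwise segments_cross F" "?\<delta> ^ 6 * card V / 2 ^ 30 \<le> card F"
      using exists_crossing_family_dense[OF V(1,2,3), of ?\<delta>] by auto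
    have s: "\<epsilon> \<le> sqrt \<epsilon>" using True \<epsilon>0 by (simp add: real_le_rsqrt power2_eq_square mult_left_le)
    \<comment> \<open>This is where the lower bound on \<open>\<epsilon>\<close> enters: the constant \<open>2 ^ 30\<close> is at most \<open>n powr (30 * sqrt \<epsilon>)\<close>.\<close>
    have "1 \<le> sqrt \<epsilon> * L"
    proof -
      have "L powr (- 1) \<le> L powr (- (2 / 3) * (1 / 2))" using L by (intro powr_mono) auto
      also have "\<dots> = sqrt (L powr (- (2 / 3)))" by (simp add: powr_powr flip: powr_half_sqrt)
      also have "\<dots> \<le> sqrt \<epsilon>" using \<epsilon> by (simp add: L_def)
      finally have "1 / L \<le> sqrt \<epsilon>" using L by (simp add: powr_minus_divide)
      then show ?thesis using L by (simp add: divide_le_eq)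
    qed
    moreover have "\<epsilon> * L \<le> sqrt \<epsilon> * L" using s L by (intro mult_right_mono) auto
    ultimately have "L * (1 - 36 * sqrt \<epsilon>) \<le> L - 6 * (\<epsilon> * L) - 30" by (simp add: algebra_simps)
    then have "real n powr (1 - 36 * sqrt \<epsilon>) \<le> 2 powr (L - 6 * (\<epsilon> * L) - 30)"
      by (simp add: nL powr_powr)
    also have "\<dots> = 2 powr (- 6 * (\<epsilon> * L)) * 2 powr L / 2 powr 30"
      by (simp add: powr_diff[of 2 _ 30] flip: powr_add)
    also have "2 powr (- 6 * (\<epsilon> * L)) = ?\<delta> ^ 6"
    proof -
      have "?\<delta> ^ 6 = ?\<delta> powr 6" using n by (simp add: powr_numeral)
      also have "\<dots> = 2 powr (L * - \<epsilon> * 6)" by (simp only: nL powr_powr)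
      also have "L * - \<epsilon> * 6 = - 6 * (\<epsilon> * L)" by (simp add: algebra_simps)
      finally show ?thesis by (rule sym)
    qed
    also have "?\<delta> ^ 6 * 2 powr L / 2 powr 30 = ?\<delta> ^ 6 * card V / 2 ^ 30"
      using V nL by (simp add: powr_numeral)
    finally have "real n powr (1 - 36 * sqrt \<epsilon>) \<le> real (card F)" using F(3) by linarith
    then show ?thesis using F(1,2) by blast
  next
    case False
    then have "1 \<le> sqrt \<epsilon>" by simp
    then have "1 - 36 * sqrt \<epsilon> \<le> 0" by linarith
    then have "real n powr (1 - 36 * sqrt \<epsilon>) \<le> real n powr 0" using n by (intro powr_mono) linarith+
    then have le1: "real n powr (1 - 36 * sqrt \<epsilon>) \<le> 1" using n by simp
    have "0 < real n powr (2 - \<epsilon>)" using n by simp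
    then have "0 < real (card E)" using E by linarith
    then obtain e where "e \<in> E" by fastforce
    then show ?thesis using le1 by (intro exI[of _ "{e}"] conjI) simp_all
  qed
qed

end
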